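(* Let $\varepsilon>0$ and $r>0$. If $z$ is a non-monotone solution (for some $\sigma\in\mathbb R$) of $$Q''(\varepsilon z')z''=F'(z)-\sigma\ \text{ in }(-\varepsilon^{-1},\varepsilon^{-1}),\qquad z'(\pm\varepsilon^{-1})=0,\qquad \int_{-\varepsilon^{-1}}^{\varepsilon^{-1}}z(x)\,dx=2r\varepsilon^{-1},$$ then $z$ is not a local minimizer of $E_\varepsilon$ over $\mathcal Z_{\varepsilon r}$.
   Context: $Q(s)=\sqrt{1+s^2}-1$. Fix $0<\overline\alpha<\underline\beta$ and $F\in C^5(0,\infty)$ (real valued) with $F''>0$ on $(0,\overline\alpha)\cup(\underline\beta,\infty)$, $F''<0$ on $(\overline\alpha,\underline\beta)$, $F'(0)<F'(\underline\beta)$ and $F'(\infty)>F'(\overline\alpha)$, where $F'(0),F'(\infty)$ denote the limits of $F'$ at $0^+$ and $+\infty$. Solutions $z$ take values in $(0,\infty)$. $$E_\varepsilon[z]=\varepsilon\int_{-\varepsilon^{-1}}^{\varepsilon^{-1}}\left[\frac{Q(\varepsilon z'(t))}{\varepsilon^2}+F(z(t))\right]dt,$$ $$\mathcal Z_{\varepsilon r}:=\left\{z\in H^1(-\varepsilon^{-1},\varepsilon^{-1}) : z>0,\ \int_{-\varepsilon^{-1}}^{\varepsilon^{-1}}z(t)\,dt=2r\varepsilon^{-1}\right\}.$$ A function $z\in\mathcal Z_{\varepsilon r}$ is a local minimizer of $E_\varepsilon$ if there is a neighborhood $\mathcal N$ of $z$ in $\mathcal Z_{\varepsilon r}$ (with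 the $H^1$ topology) such that $E_\varepsilon[z]\le E_\varepsilon[y]$ for all $y\in\mathcal N$. Constant functions count as monotone. *)

theory Defs
  imports "HOL-Analysis.Analysis"
begin

definition Ck_on :: "nat \<Rightarrow> (real \<Rightarrow> real) \<Rightarrow> real set \<Rightarrow> bool"
  where "Ck_on k f S \<longleftrightarrow>
    (\<forall>j<k. ((deriv ^^ j) f) differentiable_on S) \<and> continuous_on S ((deriv ^^ k) f)"

definition Q :: "real \<Rightarrow> real"
  where "Q s = sqrt (1 + s\<^sup>2) - 1"

section \<open>The Sobolev space \<open>H\<^sup>1\<close> of a bounded open interval\<close>

text \<open>
  Elements are represented by functions on the real line, of which only the values on \<open>(a, b)\<close>
  matter, up to null sets.  The weak derivative is tested against \<open>C\<^sup>1\<close> functions with compact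
  support in \<open>(a, b)\<close>; by mollification this gives the same notion as smooth test functions.
\<close>

definition test_function :: "real \<Rightarrow> real \<Rightarrow> (real \<Rightarrow> real) \<Rightarrow> bool"
  where "test_function a b \<phi> \<longleftrightarrow>
    \<phi> C1_differentiable_on UNIV \<and>
    compact (closure {t. \<phi> t \<noteq> 0}) \<and> closure {t. \<phi> t \<noteq> 0} \<subseteq> {a<..<b}"

definition L2 :: "real \<Rightarrow> real \<Rightarrow> (real \<Rightarrow> real) set"
  where "L2 a b = {u. u \<in> borel_measurable (lebesgue_on {a<..<b}) \<and>
    integrable (lebesgue_on {a<..<b}) (\<lambda>t. (u t)\<^sup>2)}"

definition L2_weak_deriv :: "real \<Rightarrow> real \<Rightarrow> (real \<Rightarrow> real) \<Rightarrow> (real \<Rightarrow> real) \<Rightarrow> bool"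
  where "L2_weak_deriv a b u g \<longleftrightarrow> g \<in> L2 a b \<and>
    (\<forall>\<phi>. test_function a b \<phi> \<longrightarrow>
      (\<integral>t. u t * deriv \<phi> t \<partial>lebesgue_on {a<..<b}) = - (\<integral>t. g t * \<phi> t \<partial>lebesgue_on {a<..<b}))"

definition H1 :: "real \<Rightarrow> real \<Rightarrow> (real \<Rightarrow> real) set"
  where "H1 a b = {u \<in> L2 a b. \<exists>g. L2_weak_deriv a b u g}"

text \<open>
  The weak derivative is unique up to null sets, so that the choice of a representative is
  immaterial wherever it occurs under an integral.
\<close>

definition wderiv :: "real \<Rightarrow> real \<Rightarrow> (real \<Rightarrow> real) \<Rightarrow> real \<Rightarrow> real"
  where "wderiv a b u = (SOME g. L2_weak_deriv a b u g)"

definition H1_norm :: "real \<Rightarrow> real \<Rightarrow> (real \<Rightarrow> real) \<Rightarrow> real"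
  where "H1_norm a b u = sqrt ((\<integral>t. (u t)\<^sup>2 \<partial>lebesgue_on {a<..<b}) +
    (\<integral>t. (wderiv a b u t)\<^sup>2 \<partial>lebesgue_on {a<..<b}))"

section \<open>The variational problem\<close>

text \<open>
  Functions in \<open>H\<^sup>1\<close> may be positive almost everywhere and still get arbitrarily close to \<open>0\<close>, where
  \<open>F\<close> may tend to \<open>\<infinity>\<close>.  The energy is therefore an extended real, the difference of the integrals
  of the positive and the negative part of the integrand (\<^const>\<open>ennreal\<close> truncates negative
  numbers to \<open>0\<close>).
\<close>

definition ext_integral :: "'a measure \<Rightarrow> ('a \<Rightarrow> real) \<Rightarrow> ereal"
  where "ext_integral M f =
    enn2ereal (\<integral>\<^sup>+ x. ennreal (f x) \<partial>M) - enn2ereal (\<integral>\<^sup>+ x. ennreal (- f x) \<partial>M)"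

definition energy :: "(real \<Rightarrow> real) \<Rightarrow> real \<Rightarrow> (real \<Rightarrow> real) \<Rightarrow> ereal"
  where "energy F \<epsilon> z = ereal \<epsilon> *
    ext_integral (lebesgue_on {- inverse \<epsilon><..<inverse \<epsilon>})
      (\<lambda>t. Q (\<epsilon> * wderiv (- inverse \<epsilon>) (inverse \<epsilon>) z t) / \<epsilon>\<^sup>2 + F (z t))"

definition admissible :: "real \<Rightarrow> real \<Rightarrow> (real \<Rightarrow> real) set"
  where "admissible \<epsilon> r = {z \<in> H1 (- inverse \<epsilon>) (inverse \<epsilon>).
    (AE t in lebesgue_on {- inverse \<epsilon><..<inverse \<epsilon>}. z t > 0) \<and>
    (\<integral>t. z t \<partial>lebesgue_on {- inverse \<epsilon><..<inverse \<epsilon>}) = 2 * r * inverse \<epsilon>}"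

definition local_minimizer :: "(real \<Rightarrow> real) \<Rightarrow> real \<Rightarrow> real \<Rightarrow> (real \<Rightarrow> real) \<Rightarrow> bool"
  where "local_minimizer F \<epsilon> r z \<longleftrightarrow> z \<in> admissible \<epsilon> r \<and>
    (\<exists>\<delta>>0. \<forall>y\<in>admissible \<epsilon> r.
      H1_norm (- inverse \<epsilon>) (inverse \<epsilon>) (\<lambda>t. y t - z t) < \<delta> \<longrightarrow> energy F \<epsilon> z \<le> energy F \<epsilon> y)"

text \<open>
  A classical solution: continuously differentiable up to the boundary (with one-sided derivatives
  there) and twice differentiable in the interior.  Continuity of the second derivative in the
  interior is a consequence of the equation.
\<close>

definition neumann_solution :: "(real \<Rightarrow> real) \<Rightarrow> real \<Rightarrow> real \<Rightarrow> (real \<Rightarrow> real) \<Rightarrow> bool"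
  where "neumann_solution F \<epsilon> \<sigma> z \<longleftrightarrow>
    (\<forall>t\<in>{- inverse \<epsilon>..inverse \<epsilon>}. z t > 0) \<and>
    (\<exists>z' z''.
      (\<forall>t\<in>{- inverse \<epsilon>..inverse \<epsilon>}.
        (z has_real_derivative z' t) (at t within {- inverse \<epsilon>..inverse \<epsilon>})) \<and>
      continuous_on {- inverse \<epsilon>..inverse \<epsilon>} z' \<and>
      (\<forall>t\<in>{- inverse \<epsilon><..<inverse \<epsilon>}. (z' has_real_derivative z'' t) (at t) \<and>
        (deriv ^^ 2) Q (\<epsilon> * z' t) * z'' t = deriv F (z t) - \<sigma>) \<and>
      z' (- inverse \<epsilon>) = 0 \<and> z' (inverse \<epsilon>) = 0)"

end

(*
A solution z has an interior critical point b because it is not monotone, and by uniqueness for the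
initial value problem it is symmetric about b on the largest interval [a,q] centred at b.  One end
of [a,q] is an end of the domain, so z' vanishes at a and q, and z(a) = z(q).  Hence z', cut off to
zero outside [a,q], is a Lipschitz variation with mean zero, and the differentiated equation makes
the second variation of the energy vanish on it.  The bilinear form of the second variation pairs it
with the mean-zero function t to (F'(z(a)) - sigma)(q - a), which is nonzero since otherwise z would
be constant.  Adding a small multiple of t therefore makes the second variation negative, while the
first variation is zero by the equation.
*)
theory Submission
  imports Defs
begin

text \<open>With W = F'(z) - \<sigma>, the equation says both that W is the derivative of the flux
  Q'(\<epsilon> z')/\<epsilon> and that W = Q''(\<epsilon> z') z''. Hence Q''(\<epsilon> z') z''^2 +
  F''(z) z'^2 is the exact derivative of W z', and for every \<psi> the mixed integrand
  Q''(\<epsilon> z') z'' \<psi>' + F''(z) z' \<psi> is that of W \<psi>. Everything on [a,q] thus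
  reduces to end values, and the pairing with \<psi> is W(a) (\<psi>(q) - \<psi>(a)); \<psi> = t is
  the simplest mean-zero choice that separates a from q. Symmetry serves the mass constraint: the
  cut-off z' has mean zero only because z(q) = z(a). Two obstacles shape the rest. The cut-off z'
  has a kink at an end of [a,q] interior to the domain, since z'' is nonzero there; variations are
  therefore piecewise C^1 functions paired with a bounded derivative. And the energy refers to an
  arbitrarily chosen weak derivative and has extended real values; uniqueness of weak derivatives,
  together with boundedness of the competitors and their slopes, turns it into an ordinary
  integral.\<close>

section \<open>Uniqueness of weak derivatives\<close>

text \<open>Open intervals form an intersection-stable generator of the Borel sets, so a Dynkin
  argument extends the vanishing of the integrals to all Borel subsets. Lebesgue sets differ from
  Borel sets by null sets only.\<close>

lemma AE_eq_0_of_interval_integrals: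
  fixes h :: "real \<Rightarrow> real"
  assumes h: "integrable (lebesgue_on {a<..<b}) h"
    and zero: "\<And>c d. a \<le> c \<Longrightarrow> d \<le> b \<Longrightarrow>
      (LINT t : {c<..<d} | lebesgue_on {a<..<b}. h t) = 0"
  shows "AE t in lebesgue_on {a<..<b}. h t = 0"
proof -
  let ?I = "{a<..<b}" and ?M = "lebesgue_on {a<..<b}"
  have si: "set_integrable ?M (A \<inter> ?I) h" if "A \<in> sets borel" for A
    unfolding set_integrable_def
    by (rule integrable_mult_indicator[OF _ h])
      (use that in \<open>auto simp: sets_restrict_space intro!: image_eqI[of _ _ A]\<close>)
  have sM: "A \<inter> ?I \<in> sets ?M" if "A \<in> sets borel" for A
    using that by (auto simp: sets_restrict_space intro!: image_eqI[of _ _ A])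
  have tot: "(LINT t : ?I | ?M. h t) = 0"
    using zero[of a b] by simp
  have borel0: "(LINT t : A \<inter> ?I | ?M. h t) = 0" if "A \<in> sets borel" for A
  proof -
    have "Int_stable (range (\<lambda>(c, d). {c<..<d::real}))"
      by (auto simp: Int_stable_def)
    moreover have "range (\<lambda>(c, d). {c<..<d::real}) \<subseteq> Pow UNIV" by auto
    moreover have B: "sets borel = sigma_sets UNIV (range (\<lambda>(c, d). {c<..<d::real}))"
      by (subst borel_eq_box) (simp add: split_def)
    then have "A \<in> sigma_sets UNIV (range (\<lambda>(c, d). {c<..<d::real}))"
      using that by simp
    ultimately show ?thesis
    proof (induction rule: sigma_sets_induct_disjoint)
      case (basic A)
      then obtain c d where A: "A = {c<..<d}" by auto
      \<comment> \<open>Clipping the generator to the domain brings it into the range of intervals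
        covered by \<open>zero\<close>.\<close>
      have "A \<inter> ?I = {max a c<..<min b d}" unfolding A by auto
      then show ?case using zero[of "max a c" "min b d"] by simp
    next
      case empty
      then show ?case by (simp add: set_lebesgue_integral_def)
    next
      case (compl A)
      then have A: "A \<in> sets borel" by (simp add: B)
      have "(LINT t : ?I | ?M. h t) = (LINT t : ((UNIV - A) \<inter> ?I) \<union> (A \<inter> ?I) | ?M. h t)"
        by (rule arg_cong[where f="\<lambda>S. set_lebesgue_integral ?M S h"]) auto
      also have "\<dots> = (LINT t : (UNIV - A) \<inter> ?I | ?M. h t) + (LINT t : A \<inter> ?I | ?M. h t)"
        by (rule set_integral_Un) (use A in \<open>auto intro!: si\<close>)
      finally show ?case using tot compl by simp
    next
      case (union A)
      then have A: "A i \<in> sets borel" for i by (auto simp: B)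
      have "(LINT t : (\<Union>i. A i \<inter> ?I) | ?M. h t) = (\<Sum>i. (LINT t : A i \<inter> ?I | ?M. h t))"
      proof (rule lebesgue_integral_countable_add)
        show "A i \<inter> ?I \<in> sets ?M" for i using A by (rule sM)
        show "A i \<inter> ?I \<inter> (A j \<inter> ?I) = {}" if "i \<noteq> j" for i j
          using union(1) that by (auto simp: disjoint_family_on_def)
        have "(\<Union>i. A i \<inter> ?I) = (\<Union>i. A i) \<inter> ?I" by auto
        then show "set_integrable ?M (\<Union>i. A i \<inter> ?I) h"
          using si[of "\<Union>i. A i"] A by auto
      qed
      then show ?case using union by (simp add: Int_UN_distrib2)
    qed
  qed
  interpret finite_measure ?M
    by (rule finite_measure_lebesgue_on) simp
  show ?thesis
  proof (rule density_zero[OF h])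
    fix A assume A: "A \<in> sets ?M"
    then have AI: "A \<subseteq> ?I" and AL: "A \<in> sets lebesgue"
      by (auto simp: sets_restrict_space)
    obtain S N N' where S: "A = S \<union> N" "N \<subseteq> N'" "N' \<in> null_sets lborel" "S \<in> sets lborel"
      using AL by (rule sets_completionE)
    then have SI: "S \<inter> ?I = S" using AI by auto
    have "(LINT t : A | ?M. h t) = (LINT t : S \<inter> ?I | ?M. h t)"
    proof (rule set_integral_null_delta[OF h A])
      show "S \<inter> ?I \<in> sets ?M" using S by (intro sM) simp
      have "(A - S \<inter> ?I) \<union> (S \<inter> ?I - A) \<in> null_sets lebesgue"
        unfolding SI
        by (rule null_sets_completion_subset[of _ N'])
          (use S null_sets_completionI in \<open>auto\<close>)
      then show "(A - S \<inter> ?I) \<union> (S \<inter> ?I - A) \<in> null_sets ?M"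
        using AI by (subst null_sets_restrict_space) auto
    qed
    then show "(LINT t : A | ?M. h t) = 0" using borel0 S by simp
  qed
qed

section \<open>C^1 cutoffs that approximate indicators of intervals\<close>

text \<open>Squaring removes the corner of the positive part: at 0 the difference quotient is
  \<open>max 0 h\<close>, which tends to 0.\<close>

lemma has_real_derivative_max_0_square:
  "((\<lambda>y. (max 0 y)\<^sup>2) has_real_derivative 2 * max 0 y) (at (y::real))"
proof -
  consider "y < 0" | "y = 0" | "y > 0" by linarith
  then show ?thesis
  proof cases
    case 1
    have "((\<lambda>y::real. 0) has_real_derivative 2 * max 0 y) (at y)" using 1 by simp
    then show ?thesis
      by (rule has_field_derivative_transform_within_open[of _ _ _ "{..<0}"]) (use 1 in auto)
  next
    case 2
    have "((\<lambda>h. max 0 h) \<longlongrightarrow> max 0 (0::real)) (at 0)"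
      by (intro tendsto_intros)
    moreover have "\<forall>\<^sub>F h in at 0. max 0 h = ((max 0 (y + h))\<^sup>2 - (max 0 y)\<^sup>2) / (h::real)"
      unfolding eventually_at_filter using 2
      by (auto simp: max_def power2_eq_square)
    ultimately show ?thesis
      unfolding DERIV_def using 2 by (auto elim: Lim_transform_eventually)
  next
    case 3
    have "((\<lambda>y::real. y\<^sup>2) has_real_derivative 2 * max 0 y) (at y)"
      using 3 by (auto intro!: derivative_eq_intros)
    then show ?thesis
      by (rule has_field_derivative_transform_within_open[of _ _ _ "{0<..}"]) (use 3 in auto)
  qed
qed

text \<open>
  The cutoff vanishes unless \<open>n (t - c) (d - t) > 1\<close>, so that its support is a compact subset of the
  \<^emph>\<open>open\<close> interval; squaring the positive part makes it \<open>C\<^sup>1\<close>.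
\<close>

definition cutoff :: "real \<Rightarrow> real \<Rightarrow> nat \<Rightarrow> real \<Rightarrow> real"
  where "cutoff c d n t =
    (let p = (max 0 (real n * ((t - c) * (d - t)) - 1))\<^sup>2 in p / (1 + p))"

lemma cutoff_bounds: "0 \<le> cutoff c d n t" "cutoff c d n t \<le> 1"
  by (auto simp: cutoff_def Let_def divide_le_eq add_pos_nonneg)

lemma cutoff_C1: "cutoff c d n C1_differentiable_on UNIV"
proof -
  let ?p = "\<lambda>t. (max 0 (real n * ((t - c) * (d - t)) - 1))\<^sup>2"
  let ?p' = "\<lambda>t. 2 * max 0 (real n * ((t - c) * (d - t)) - 1) * (real n * (c + d - 2 * t))"
  have p: "(?p has_real_derivative ?p' t) (at t)" for t
    by (rule DERIV_chain2[OF has_real_derivative_max_0_square])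
      (auto intro!: derivative_eq_intros simp: algebra_simps)
  have ne: "1 + ?p t \<noteq> 0" for t
    using add_pos_nonneg[OF zero_less_one zero_le_power2] by (metis less_irrefl)
  have D: "(cutoff c d n has_real_derivative
      (?p' t * (1 + ?p t) - ?p t * ?p' t) / ((1 + ?p t) * (1 + ?p t))) (at t)" for t
    unfolding cutoff_def Let_def
    by (rule derivative_eq_intros p ne | simp)+
  have C: "continuous_on UNIV (\<lambda>t. (?p' t * (1 + ?p t) - ?p t * ?p' t) / ((1 + ?p t) * (1 + ?p t)))"
    using ne by (intro continuous_intros) auto
  show ?thesis
    unfolding C1_differentiable_on_def using D C
    by (intro exI[of _ "\<lambda>t. (?p' t * (1 + ?p t) - ?p t * ?p' t) / ((1 + ?p t) * (1 + ?p t))"])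
      (simp add: has_real_derivative_iff_has_vector_derivative)
qed

lemma test_function_cutoff:
  assumes "a \<le> c" "c \<le> d" "d \<le> b"
  shows "test_function a b (cutoff c d n)"
proof -
  let ?K = "{t. 1 \<le> real n * ((t - c) * (d - t))}"
  have "{t. cutoff c d n t \<noteq> 0} \<subseteq> ?K"
    by (auto simp: cutoff_def Let_def)
  moreover have "closed ?K"
    by (intro closed_Collect_le continuous_intros)
  ultimately have cl: "closure {t. cutoff c d n t \<noteq> 0} \<subseteq> ?K"
    by (rule closure_minimal)
  have K: "?K \<subseteq> {c<..<d}"
  proof
    fix t assume "t \<in> ?K"
    then have "0 < real n * ((t - c) * (d - t))" by simp
    then have "0 < (t - c) * (d - t)"
      by (metis mult_nonneg_nonpos not_le of_nat_0_le_iff)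
    \<comment> \<open>A positive product could also come from two negative factors;
      \<open>c \<le> d\<close> excludes this.\<close>
    then show "t \<in> {c<..<d}" using assms(2) by (auto simp: zero_less_mult_iff)
  qed
  have "bounded (closure {t. cutoff c d n t \<noteq> 0})"
    using cl K by (meson bounded_Ioo bounded_subset subset_trans)
  then show ?thesis
    unfolding test_function_def using cl K assms
    by (auto simp: cutoff_C1 compact_eq_bounded_closed)
qed

text \<open>At interior points the squared term p tends to infinity, and p / (1 + p) converts this
  into convergence to 1. The same quotient keeps all values in [0,1], as dominated convergence will
  require.\<close>

lemma cutoff_tendsto:
  assumes "c \<le> d"
  shows "(\<lambda>n. cutoff c d n t) \<longlonglongrightarrow> indicator {c<..<d} t"
proof (cases "t \<in> {c<..<d}")
  case True
  then have pos: "0 < (t - c) * (d - t)" by simp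
  have "filterlim (\<lambda>n. real n * ((t - c) * (d - t)) - 1) at_top sequentially"
    using filterlim_tendsto_add_at_top[OF tendsto_const[of "-1"]
        filterlim_tendsto_pos_mult_at_top[OF tendsto_const pos filterlim_real_sequentially]]
    by (simp add: algebra_simps)
  then have "filterlim (\<lambda>n. (real n * ((t - c) * (d - t)) - 1)\<^sup>2) at_top sequentially"
    by (intro filterlim_pow_at_top) auto
  moreover have "\<forall>\<^sub>F n in sequentially. 0 \<le> real n * ((t - c) * (d - t)) - 1"
    using \<open>filterlim (\<lambda>n. real n * ((t - c) * (d - t)) - 1) at_top sequentially\<close>
    unfolding filterlim_at_top by blast
  ultimately have p: "filterlim (\<lambda>n. (max 0 (real n * ((t - c) * (d - t)) - 1))\<^sup>2) at_top sequentially"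
    by (auto elim!: filterlim_mono_eventually eventually_mono simp: max_def)
  have "\<forall>\<^sub>F x::real in at_top. 1 - inverse (1 + x) = x / (1 + x)"
    using eventually_gt_at_top[of "0::real"] by eventually_elim (simp add: field_simps)
  moreover have "((\<lambda>x::real. 1 - inverse (1 + x)) \<longlongrightarrow> 1 - 0) at_top"
    by (intro tendsto_intros tendsto_inverse_0_at_top filterlim_tendsto_add_at_top[OF tendsto_const]
        filterlim_ident)
  ultimately have "((\<lambda>x::real. x / (1 + x)) \<longlongrightarrow> 1) at_top"
    using Lim_transform_eventually by fastforce
  from filterlim_compose[OF this p] show ?thesis
    using True by (simp add: cutoff_def Let_def)
next
  case False
  then have "(t - c) * (d - t) \<le> 0" using assms by (auto simp: mult_le_0_iff)
  then have "max 0 (real n * ((t - c) * (d - t)) - 1) = 0" for n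
    by (smt (verit) mult_nonneg_nonpos of_nat_0_le_iff)
  then show ?thesis using False by (simp add: cutoff_def Let_def)
qed

lemma L2_integrable:
  assumes "u \<in> L2 a b"
  shows "integrable (lebesgue_on {a<..<b}) u"
proof -
  interpret finite_measure "lebesgue_on {a<..<b}"
    by (rule finite_measure_lebesgue_on) simp
  have u: "u \<in> borel_measurable (lebesgue_on {a<..<b})"
    "integrable (lebesgue_on {a<..<b}) (\<lambda>t. (u t)\<^sup>2)"
    using assms by (auto simp: L2_def)
  show ?thesis
  proof (rule Bochner_Integration.integrable_bound)
    show "integrable (lebesgue_on {a<..<b}) (\<lambda>t. 1 + (u t)\<^sup>2)"
      using u by simp
    have "\<bar>x\<bar> \<le> 1 + x\<^sup>2" for x :: real
    proof -
      have "0 \<le> (\<bar>x\<bar> - 1)\<^sup>2" by simp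
      also have "\<dots> = x\<^sup>2 - 2 * \<bar>x\<bar> + 1" by (simp add: power2_diff)
      finally show ?thesis using zero_le_power2[of x] by linarith
    qed
    then show "AE t in lebesgue_on {a<..<b}. norm (u t) \<le> norm (1 + (u t)\<^sup>2)"
      by (simp add: add_nonneg_nonneg)
  qed (rule u)
qed

lemma integrable_mult_bounded:
  fixes f g :: "'a \<Rightarrow> real"
  assumes "integrable M f" "g \<in> borel_measurable M" "\<And>x. x \<in> space M \<Longrightarrow> \<bar>g x\<bar> \<le> C"
  shows "integrable M (\<lambda>x. f x * g x)"
proof (rule Bochner_Integration.integrable_bound)
  show "integrable M (\<lambda>x. C * f x)" using assms by simp
  show "AE x in M. norm (f x * g x) \<le> norm (C * f x)"
  proof (rule AE_I2)
    fix x assume "x \<in> space M"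
    then have "\<bar>f x\<bar> * \<bar>g x\<bar> \<le> \<bar>f x\<bar> * \<bar>C\<bar>"
      using assms(3)[of x] by (intro mult_left_mono) auto
    then show "norm (f x * g x) \<le> norm (C * f x)" by (simp add: abs_mult mult.commute)
  qed
qed (use assms in measurable)

lemma C1_differentiable_on_continuous:
  fixes f :: "real \<Rightarrow> real"
  assumes "f C1_differentiable_on UNIV"
  shows "continuous_on UNIV f" "continuous_on UNIV (deriv f)"
    "(f has_real_derivative deriv f t) (at t)"
proof -
  obtain D where D: "\<And>x. (f has_real_derivative D x) (at x)" "continuous_on UNIV D"
    using assms unfolding C1_differentiable_on_def has_real_derivative_iff_has_vector_derivative
    by auto
  have "deriv f = D" using D(1) by (auto intro: DERIV_imp_deriv)
  then show "continuous_on UNIV (deriv f)" "(f has_real_derivative deriv f t) (at t)"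
    using D by auto
  show "continuous_on UNIV f" using D(1) by (intro continuous_at_imp_continuous_on ballI DERIV_isCont)
qed

text \<open>Testing both derivatives against cutoffs that converge to the indicator of a subinterval
  shows that their integrals over every subinterval agree.\<close>

lemma L2_weak_deriv_unique:
  assumes "L2_weak_deriv a b u g" "L2_weak_deriv a b u h"
  shows "AE t in lebesgue_on {a<..<b}. g t = h t"
proof -
  let ?M = "lebesgue_on {a<..<b}"
  have int: "integrable ?M g" "integrable ?M h"
    using assms by (auto simp: L2_weak_deriv_def intro: L2_integrable)
  have "AE t in ?M. g t - h t = 0"
  proof (rule AE_eq_0_of_interval_integrals)
    show gh: "integrable ?M (\<lambda>t. g t - h t)" using int by simp
    fix c d assume cd: "a \<le> c" "d \<le> b"
    show "(LINT t : {c<..<d} | ?M. g t - h t) = 0"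
    proof (cases "c \<le> d")
      case True
      have meas: "cutoff c d n \<in> borel_measurable ?M" for n
        using C1_differentiable_on_continuous(1)[OF cutoff_C1]
        by (intro continuous_imp_measurable_on_sets_lebesgue) (auto intro: continuous_on_subset)
      have "(\<integral>t. cutoff c d n t * (g t - h t) \<partial>?M) = 0" for n
      proof -
        have tf: "test_function a b (cutoff c d n)"
          using test_function_cutoff cd True by blast
        have *: "integrable ?M (\<lambda>t. g t * cutoff c d n t)" "integrable ?M (\<lambda>t. h t * cutoff c d n t)"
          using cutoff_bounds meas int by (auto intro!: integrable_mult_bounded[where C=1])
        have "(\<integral>t. g t * cutoff c d n t \<partial>?M) = (\<integral>t. h t * cutoff c d n t \<partial>?M)"
          using assms[unfolded L2_weak_deriv_def, THEN conjunct2, rule_format, OF tf] by linarith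
        then show ?thesis using * by (simp add: algebra_simps)
      qed
      moreover have "(\<lambda>n. \<integral>t. cutoff c d n t * (g t - h t) \<partial>?M) \<longlonglongrightarrow>
          (\<integral>t. indicator {c<..<d} t * (g t - h t) \<partial>?M)"
      proof (rule integral_dominated_convergence)
        show "integrable ?M (\<lambda>t. \<bar>g t - h t\<bar>)" using gh by simp
        show "AE t in ?M. (\<lambda>n. cutoff c d n t * (g t - h t)) \<longlonglongrightarrow> indicator {c<..<d} t * (g t - h t)"
          using cutoff_tendsto[OF True] by (intro AE_I2 tendsto_intros)
        show "AE t in ?M. norm (cutoff c d n t * (g t - h t)) \<le> \<bar>g t - h t\<bar>" for n
          using cutoff_bounds by (intro AE_I2) (simp add: abs_mult mult_left_le_one_le)
        show "(\<lambda>t. cutoff c d n t * (g t - h t)) \<in> borel_measurable ?M" for n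
          using meas gh by (intro borel_measurable_times) auto
        have "indicat_real {c<..<d} \<in> borel_measurable ?M"
          by (intro borel_measurable_indicator) (use cd in \<open>auto simp: sets_restrict_space\<close>)
        then show "(\<lambda>t. indicator {c<..<d} t * (g t - h t)) \<in> borel_measurable ?M"
          using gh by (intro borel_measurable_times) auto
      qed
      ultimately have "(\<integral>t. indicator {c<..<d} t * (g t - h t) \<partial>?M) = 0"
        by (simp add: LIMSEQ_const_iff)
      then show ?thesis by (simp add: set_lebesgue_integral_def)
    qed (simp add: set_lebesgue_integral_def)
  qed
  then show ?thesis by simp
qed

section \<open>Piecewise continuously differentiable functions\<close>

text \<open>The derivative is an argument of the relation, so that it may jump or take arbitrary
  bounded values on a finite set. Continuity of \<open>u\<close> across that set is what makes the
  fundamental theorem of calculus hold; boundedness and continuity of \<open>g\<close> off the set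
  give measurability and square integrability.\<close>

definition pw_deriv :: "real \<Rightarrow> real \<Rightarrow> (real \<Rightarrow> real) \<Rightarrow> (real \<Rightarrow> real) \<Rightarrow> bool"
  where "pw_deriv a b u g \<longleftrightarrow> continuous_on {a..b} u \<and> bounded (g ` {a<..<b}) \<and>
    (\<exists>S. finite S \<and> (\<forall>t\<in>{a<..<b} - S. (u has_real_derivative g t) (at t)) \<and>
      continuous_on ({a<..<b} - S) g)"

lemma pw_derivI:
  assumes "continuous_on {a..b} u" "bounded (g ` {a<..<b})" "finite S"
    "\<And>t. t \<in> {a<..<b} - S \<Longrightarrow> (u has_real_derivative g t) (at t)"
    "continuous_on ({a<..<b} - S) g"
  shows "pw_deriv a b u g"
  using assms unfolding pw_deriv_def by blast

lemma pw_deriv_add: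
  assumes "pw_deriv a b u g" "pw_deriv a b v h"
  shows "pw_deriv a b (\<lambda>t. u t + v t) (\<lambda>t. g t + h t)"
proof -
  obtain S where S: "finite S" "\<And>t. t \<in> {a<..<b} - S \<Longrightarrow> (u has_real_derivative g t) (at t)"
    "continuous_on ({a<..<b} - S) g" using assms(1) unfolding pw_deriv_def by blast
  obtain T where T: "finite T" "\<And>t. t \<in> {a<..<b} - T \<Longrightarrow> (v has_real_derivative h t) (at t)"
    "continuous_on ({a<..<b} - T) h" using assms(2) unfolding pw_deriv_def by blast
  show ?thesis
  proof (rule pw_derivI[where S = "S \<union> T"])
    show "continuous_on {a..b} (\<lambda>t. u t + v t)"
      using assms by (auto simp: pw_deriv_def intro!: continuous_intros)
    show "bounded ((\<lambda>t. g t + h t) ` {a<..<b})"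
      using assms by (auto simp: pw_deriv_def intro!: bounded_plus_comp)
    show "continuous_on ({a<..<b} - (S \<union> T)) (\<lambda>t. g t + h t)"
      using S T by (intro continuous_on_add) (auto intro: continuous_on_subset)
    show "((\<lambda>t. u t + v t) has_real_derivative g t + h t) (at t)" if "t \<in> {a<..<b} - (S \<union> T)" for t
      using S(2) T(2) that by (auto intro!: DERIV_add)
  qed (use S T in simp)
qed

lemma bounded_mult_comp:
  fixes f g :: "'a \<Rightarrow> real"
  assumes "bounded (f ` S)" "bounded (g ` S)"
  shows "bounded ((\<lambda>x. f x * g x) ` S)"
proof -
  obtain B C where "\<And>x. x \<in> S \<Longrightarrow> \<bar>f x\<bar> \<le> B" "\<And>x. x \<in> S \<Longrightarrow> \<bar>g x\<bar> \<le> C"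
    using assms by (auto simp: bounded_iff)
  then have "\<bar>f x * g x\<bar> \<le> B * C" if "x \<in> S" for x
    unfolding abs_mult using that by (meson abs_ge_zero mult_mono order_trans)
  then show ?thesis by (auto simp: bounded_iff)
qed

lemma bounded_continuous_image:
  fixes u :: "real \<Rightarrow> real"
  assumes "continuous_on {a..b} u"
  shows "bounded (u ` {a<..<b})"
  by (meson assms bounded_subset compact_Icc compact_continuous_image compact_imp_bounded
      greaterThanLessThan_subseteq_atLeastAtMost_iff image_mono order_refl)

lemma pw_deriv_mult:
  assumes "pw_deriv a b u g" "pw_deriv a b v h"
  shows "pw_deriv a b (\<lambda>t. u t * v t) (\<lambda>t. u t * h t + g t * v t)"
proof -
  obtain S where S: "finite S" "\<And>t. t \<in> {a<..<b} - S \<Longrightarrow> (u has_real_derivative g t) (at t)"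
    "continuous_on ({a<..<b} - S) g" using assms(1) unfolding pw_deriv_def by blast
  obtain T where T: "finite T" "\<And>t. t \<in> {a<..<b} - T \<Longrightarrow> (v has_real_derivative h t) (at t)"
    "continuous_on ({a<..<b} - T) h" using assms(2) unfolding pw_deriv_def by blast
  have uv: "continuous_on {a..b} u" "continuous_on {a..b} v"
    using assms by (auto simp: pw_deriv_def)
  have sub: "{a<..<b} - (S \<union> T) \<subseteq> {a..b}" by auto
  show ?thesis
  proof (rule pw_derivI[where S = "S \<union> T"])
    show "continuous_on {a..b} (\<lambda>t. u t * v t)"
      using uv by (intro continuous_intros)
    show "bounded ((\<lambda>t. u t * h t + g t * v t) ` {a<..<b})"
      using assms bounded_continuous_image[OF uv(1)] bounded_continuous_image[OF uv(2)]
      by (intro bounded_plus_comp bounded_mult_comp) (auto simp: pw_deriv_def)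
    show "continuous_on ({a<..<b} - (S \<union> T)) (\<lambda>t. u t * h t + g t * v t)"
      using S T uv sub by (intro continuous_intros) (auto intro: continuous_on_subset)
    show "((\<lambda>t. u t * v t) has_real_derivative u t * h t + g t * v t) (at t)"
      if "t \<in> {a<..<b} - (S \<union> T)" for t
      using DERIV_mult'[OF S(2) T(2)] that by auto
  qed (use S T in simp)
qed

lemma pw_deriv_C1:
  assumes "\<And>t. t \<in> {a..b} \<Longrightarrow> (u has_real_derivative g t) (at t within {a..b})"
    and "continuous_on {a..b} g"
  shows "pw_deriv a b u g"
proof (rule pw_derivI[where S = "{}"])
  show "continuous_on {a..b} u"
    using assms(1) by (rule DERIV_continuous_on)
  show "bounded (g ` {a<..<b})"
    using assms(2) by (rule bounded_continuous_image)
  show "continuous_on ({a<..<b} - {}) g"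
    using assms(2) by (rule continuous_on_subset) auto
  show "(u has_real_derivative g t) (at t)" if "t \<in> {a<..<b} - {}" for t
    using assms(1)[of t] that by (simp add: at_within_Icc_at)
qed simp

lemma pw_deriv_const: "pw_deriv a b (\<lambda>_. c) (\<lambda>_. 0)"
  by (rule pw_deriv_C1) auto

lemma pw_deriv_cmult:
  assumes "pw_deriv a b u g"
  shows "pw_deriv a b (\<lambda>t. c * u t) (\<lambda>t. c * g t)"
  using pw_deriv_mult[OF pw_deriv_const assms, of c] by simp

lemma pw_deriv_has_integral:
  assumes "a \<le> b" "pw_deriv a b u g"
  shows "(g has_integral (u b - u a)) {a..b}"
proof -
  obtain S where S: "finite S" "\<And>t. t \<in> {a<..<b} - S \<Longrightarrow> (u has_real_derivative g t) (at t)"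
    using assms(2) unfolding pw_deriv_def by blast
  show ?thesis
    by (rule fundamental_theorem_of_calculus_interior_strong[OF S(1) assms(1)])
      (use S assms in \<open>auto simp: has_real_derivative_iff_has_vector_derivative[symmetric] pw_deriv_def\<close>)
qed

text \<open>Extended by zero, the function is continuous on the whole line except at the points of
  \<open>S\<close> and the two endpoints, hence Borel.\<close>

lemma measurable_of_continuous_finite_exceptions:
  fixes g :: "real \<Rightarrow> real"
  assumes "finite S" "continuous_on ({a<..<b} - S) g"
  shows "g \<in> borel_measurable (lebesgue_on {a<..<b})"
proof -
  let ?g = "\<lambda>t. if t \<in> {a<..<b} then g t else 0"
  have o: "open ({a<..<b} - S)" "open (({..<a} \<union> {b<..}) - S)"
    using assms(1) by (auto intro!: open_Diff finite_imp_closed)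
  have "continuous_on (({a<..<b} - S) \<union> (({..<a} \<union> {b<..}) - S - {a<..<b})) ?g"
  proof (rule continuous_on_open_Un)
    show "continuous_on ({a<..<b} - S) ?g"
      using assms(2) by (rule continuous_on_eq) auto
    have "({..<a} \<union> {b<..}) - S - {a<..<b} = (if a < b then ({..<a} \<union> {b<..}) - S else ({..<a} \<union> {b<..}) - S)"
      by auto
    then show "open (({..<a} \<union> {b<..}) - S - {a<..<b})" using o by auto
    show "continuous_on (({..<a} \<union> {b<..}) - S - {a<..<b}) ?g"
      by (rule continuous_on_eq[OF continuous_on_const[of _ 0]]) auto
  qed (use o in simp)
  moreover have "- (S \<union> {a, b}) \<subseteq> ({a<..<b} - S) \<union> (({..<a} \<union> {b<..}) - S - {a<..<b})" by auto
  ultimately have "continuous_on (- (S \<union> {a, b})) ?g" by (rule continuous_on_subset)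
  then have "?g \<in> borel_measurable borel"
    using assms(1) by (intro borel_measurable_continuous_countable_exceptions[of "S \<union> {a, b}"])
      (auto intro: countable_finite)
  then have "?g \<in> borel_measurable lebesgue" by (simp add: measurable_completion)
  then have "?g \<in> borel_measurable (lebesgue_on {a<..<b})" by (rule measurable_restrict_space1)
  then show ?thesis
    by (rule measurable_cong[THEN iffD1, rotated]) simp
qed

lemma pw_deriv_measurable:
  assumes "pw_deriv a b u g"
  shows "g \<in> borel_measurable (lebesgue_on {a<..<b})"
  using assms measurable_of_continuous_finite_exceptions unfolding pw_deriv_def by blast

lemma integrable_bounded_interval:
  fixes f :: "real \<Rightarrow> real"
  assumes "f \<in> borel_measurable (lebesgue_on {a<..<b})" "\<And>t. t \<in> {a<..<b} \<Longrightarrow> \<bar>f t\<bar> \<le> C"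
  shows "integrable (lebesgue_on {a<..<b}) f"
proof -
  interpret finite_measure "lebesgue_on {a<..<b}"
    by (rule finite_measure_lebesgue_on) simp
  show ?thesis
    using assms by (intro integrable_const_bound[of _ C]) auto
qed

lemma integrable_bounded_image:
  fixes f :: "real \<Rightarrow> real"
  assumes "f \<in> borel_measurable (lebesgue_on {a<..<b})" "bounded (f ` {a<..<b})"
  shows "integrable (lebesgue_on {a<..<b}) f"
proof -
  obtain C where "\<And>t. t \<in> {a<..<b} \<Longrightarrow> \<bar>f t\<bar> \<le> C"
    using assms(2) unfolding bounded_iff by (metis imageI real_norm_def)
  then show ?thesis using assms(1) by (intro integrable_bounded_interval)
qed

lemma continuous_on_Icc_measurable:
  fixes f :: "real \<Rightarrow> real"
  assumes "continuous_on {a..b} f"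
  shows "f \<in> borel_measurable (lebesgue_on {a<..<b})"
  using assms by (intro measurable_of_continuous_finite_exceptions[of "{}"])
    (auto intro: continuous_on_subset)

lemma lebesgue_on_integral_eqI:
  fixes f :: "real \<Rightarrow> real"
  assumes "(f has_integral c) {a..b}" "integrable (lebesgue_on {a<..<b}) f"
  shows "(\<integral>t. f t \<partial>lebesgue_on {a<..<b}) = c"
proof -
  have "(\<integral>t. f t \<partial>lebesgue_on {a<..<b}) = integral {a<..<b} f"
    by (rule lebesgue_integral_eq_integral[OF assms(2)]) simp
  also have "\<dots> = integral {a..b} f" by (rule integral_open_interval_real[symmetric])
  also have "\<dots> = c" using assms(1) by (rule integral_unique)
  finally show ?thesis .
qed

lemma pw_deriv_integral:
  assumes "a \<le> b" "pw_deriv a b u g"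
  shows "integrable (lebesgue_on {a<..<b}) g"
    "(\<integral>t. g t \<partial>lebesgue_on {a<..<b}) = u b - u a"
proof -
  show "integrable (lebesgue_on {a<..<b}) g"
    using assms(2) by (intro integrable_bounded_image pw_deriv_measurable) (auto simp: pw_deriv_def)
  then show "(\<integral>t. g t \<partial>lebesgue_on {a<..<b}) = u b - u a"
    using pw_deriv_has_integral[OF assms] by (rule lebesgue_on_integral_eqI[rotated])
qed

lemma pw_deriv_L2_integrable:
  assumes "pw_deriv a b u g"
  shows "integrable (lebesgue_on {a<..<b}) (\<lambda>t. (u t)\<^sup>2)" "integrable (lebesgue_on {a<..<b}) (\<lambda>t. (g t)\<^sup>2)"
proof -
  have c: "continuous_on {a..b} u" and "bounded (g ` {a<..<b})"
    using assms by (auto simp: pw_deriv_def)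
  then have "bounded ((\<lambda>t. g t * g t) ` {a<..<b})" by (intro bounded_mult_comp)
  then show "integrable (lebesgue_on {a<..<b}) (\<lambda>t. (g t)\<^sup>2)"
    using pw_deriv_measurable[OF assms] unfolding power2_eq_square
    by (intro integrable_bounded_image) auto
  have "continuous_on {a..b} (\<lambda>t. u t * u t)" using c by (intro continuous_intros)
  then show "integrable (lebesgue_on {a<..<b}) (\<lambda>t. (u t)\<^sup>2)"
    unfolding power2_eq_square
    by (intro integrable_bounded_image continuous_on_Icc_measurable bounded_continuous_image)
qed

section \<open>Weak derivatives and energies of piecewise C^1 functions\<close>

text \<open>Applied at the endpoints, this removes the boundary terms when integrating by
  parts.\<close>

lemma test_function_outside:
  assumes "test_function a b \<phi>" "t \<notin> {a<..<b}"
  shows "\<phi> t = 0"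
proof (rule ccontr)
  assume "\<phi> t \<noteq> 0"
  then have "t \<in> closure {t. \<phi> t \<noteq> 0}"
    using closure_subset[of "{t. \<phi> t \<noteq> 0}"] by (simp add: subset_iff)
  then show False using assms unfolding test_function_def by blast
qed

text \<open>A test function is itself piecewise C^1, so the product rule and the fundamental theorem
  of calculus give integration by parts.\<close>

lemma pw_deriv_weak_deriv:
  assumes "a \<le> b" "pw_deriv a b u g"
  shows "L2_weak_deriv a b u g"
  unfolding L2_weak_deriv_def
proof (intro conjI allI impI)
  show "g \<in> L2 a b"
    using assms by (auto simp: L2_def intro: pw_deriv_measurable pw_deriv_L2_integrable)
  fix \<phi> assume \<phi>: "test_function a b \<phi>"
  then have C1: "\<phi> C1_differentiable_on UNIV" by (simp add: test_function_def)
  have pw: "pw_deriv a b \<phi> (deriv \<phi>)"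
    by (rule pw_deriv_C1)
      (auto intro: C1_differentiable_on_continuous[OF C1] continuous_on_subset has_field_derivative_at_within)
  have c: "continuous_on {a..b} u" "continuous_on {a..b} \<phi>" "continuous_on {a..b} (deriv \<phi>)"
    using assms pw C1_differentiable_on_continuous(2)[OF C1]
    by (auto simp: pw_deriv_def intro: continuous_on_subset)
  have i1: "integrable (lebesgue_on {a<..<b}) (\<lambda>t. u t * deriv \<phi> t)"
    using c by (intro integrable_bounded_image continuous_on_Icc_measurable bounded_continuous_image
        continuous_on_mult)
  have i2: "integrable (lebesgue_on {a<..<b}) (\<lambda>t. g t * \<phi> t)"
    using assms pw_deriv_measurable[OF assms(2)] continuous_on_Icc_measurable[OF c(2)]
      bounded_continuous_image[OF c(2)]
    by (intro integrable_bounded_image bounded_mult_comp borel_measurable_times)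
      (auto simp: pw_deriv_def)
  have "(\<integral>t. u t * deriv \<phi> t + g t * \<phi> t \<partial>lebesgue_on {a<..<b}) = u b * \<phi> b - u a * \<phi> a"
    by (rule pw_deriv_integral[OF assms(1) pw_deriv_mult[OF assms(2) pw]])
  also have "\<dots> = 0" using test_function_outside[OF \<phi>, of a] test_function_outside[OF \<phi>, of b] by simp
  finally show "(\<integral>t. u t * deriv \<phi> t \<partial>lebesgue_on {a<..<b}) = - (\<integral>t. g t * \<phi> t \<partial>lebesgue_on {a<..<b})"
    using i1 i2 by simp
qed

lemma pw_deriv_H1:
  assumes "a \<le> b" "pw_deriv a b u g"
  shows "u \<in> H1 a b"
proof -
  have "u \<in> L2 a b" using assms
    by (auto simp: L2_def pw_deriv_def intro: continuous_on_Icc_measurable pw_deriv_L2_integrable(1)[OF assms(2)])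
  then show ?thesis using pw_deriv_weak_deriv[OF assms] by (auto simp: H1_def)
qed

text \<open>Lets an explicit derivative replace the unspecified choice made in \<open>wderiv\<close>
  under any integral.\<close>

lemma AE_wderiv_eq:
  assumes "L2_weak_deriv a b u g"
  shows "AE t in lebesgue_on {a<..<b}. wderiv a b u t = g t"
proof -
  have "L2_weak_deriv a b u (wderiv a b u)"
    unfolding wderiv_def by (rule someI[of _ g]) (rule assms)
  then show ?thesis using assms by (rule L2_weak_deriv_unique)
qed

lemma H1_norm_eq:
  assumes "L2_weak_deriv a b u g"
  shows "H1_norm a b u = sqrt ((\<integral>t. (u t)\<^sup>2 \<partial>lebesgue_on {a<..<b}) + (\<integral>t. (g t)\<^sup>2 \<partial>lebesgue_on {a<..<b}))"
proof -
  have w: "L2_weak_deriv a b u (wderiv a b u)"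
    unfolding wderiv_def by (rule someI[of _ g]) (rule assms)
  have "(\<integral>t. (wderiv a b u t)\<^sup>2 \<partial>lebesgue_on {a<..<b}) = (\<integral>t. (g t)\<^sup>2 \<partial>lebesgue_on {a<..<b})"
    using w assms AE_wderiv_eq[OF assms]
    by (intro integral_cong_AE) (auto simp: L2_weak_deriv_def L2_def)
  then show ?thesis by (simp add: H1_norm_def)
qed

text \<open>Integrability makes both parts finite, so the difference of extended reals is a genuine
  one.\<close>

lemma ext_integral_eq:
  assumes "integrable M f"
  shows "ext_integral M f = ereal (\<integral>x. f x \<partial>M)"
proof -
  have "(\<integral>\<^sup>+ x. ennreal (f x) \<partial>M) < \<infinity>" "(\<integral>\<^sup>+ x. ennreal (- f x) \<partial>M) < \<infinity>"
    using assms integrable_iff_bounded real_integrable_def by (auto simp: less_top)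
  then show ?thesis
    unfolding ext_integral_def real_lebesgue_integral_def[OF assms]
    by (cases "\<integral>\<^sup>+ x. ennreal (f x) \<partial>M"; cases "\<integral>\<^sup>+ x. ennreal (- f x) \<partial>M") auto
qed

lemma ext_integral_cong_AE:
  assumes "AE x in M. f x = g x"
  shows "ext_integral M f = ext_integral M g"
proof -
  have "(\<integral>\<^sup>+ x. ennreal (f x) \<partial>M) = (\<integral>\<^sup>+ x. ennreal (g x) \<partial>M)"
    "(\<integral>\<^sup>+ x. ennreal (- f x) \<partial>M) = (\<integral>\<^sup>+ x. ennreal (- g x) \<partial>M)"
    using assms by (auto intro!: nn_integral_cong_AE elim: eventually_mono)
  then show ?thesis by (simp add: ext_integral_def)
qed

lemma energy_eq:
  assumes "L2_weak_deriv (- inverse \<epsilon>) (inverse \<epsilon>) u g"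
    and "integrable (lebesgue_on {- inverse \<epsilon><..<inverse \<epsilon>}) (\<lambda>t. Q (\<epsilon> * g t) / \<epsilon>\<^sup>2 + F (u t))"
  shows "energy F \<epsilon> u =
    ereal (\<epsilon> * (\<integral>t. Q (\<epsilon> * g t) / \<epsilon>\<^sup>2 + F (u t) \<partial>lebesgue_on {- inverse \<epsilon><..<inverse \<epsilon>}))"
proof -
  have "ext_integral (lebesgue_on {- inverse \<epsilon><..<inverse \<epsilon>})
      (\<lambda>t. Q (\<epsilon> * wderiv (- inverse \<epsilon>) (inverse \<epsilon>) u t) / \<epsilon>\<^sup>2 + F (u t)) =
    ext_integral (lebesgue_on {- inverse \<epsilon><..<inverse \<epsilon>}) (\<lambda>t. Q (\<epsilon> * g t) / \<epsilon>\<^sup>2 + F (u t))"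
    by (rule ext_integral_cong_AE, rule eventually_mono[OF AE_wderiv_eq[OF assms(1)]]) simp
  then show ?thesis unfolding energy_def by (simp add: ext_integral_eq[OF assms(2)])
qed

text \<open>Clamping the argument continues \<open>u\<close> by its end values, so the derivative
  becomes 0 outside and the kinks at \<open>c\<close> and \<open>d\<close> join the exceptional set.
  If \<open>u\<close> vanishes at both ends this is extension by zero; in general it supplies
  primitives of integrands that are cut off to a subinterval.\<close>

lemma pw_deriv_clamp:
  assumes "pw_deriv c d u g" "a \<le> c" "c \<le> d" "d \<le> b"
  shows "pw_deriv a b (\<lambda>t. u (max c (min d t))) (\<lambda>t. if t \<in> {c<..<d} then g t else 0)"
proof -
  obtain S where S: "finite S" "\<And>t. t \<in> {c<..<d} - S \<Longrightarrow> (u has_real_derivative g t) (at t)"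
    "continuous_on ({c<..<d} - S) g" using assms(1) unfolding pw_deriv_def by blast
  let ?g = "\<lambda>t. if t \<in> {c<..<d} then g t else 0"
  let ?u = "\<lambda>t. u (max c (min d t))"
  let ?O = "({..<c} \<union> {d<..})"
  show ?thesis
  proof (rule pw_derivI[where S = "S \<union> {c, d}"])
    show "continuous_on {a..b} ?u"
    proof (rule continuous_on_compose2[of "{c..d}" u])
      show "continuous_on {c..d} u" using assms(1) by (simp add: pw_deriv_def)
      show "continuous_on {a..b} (\<lambda>t. max c (min d t))" by (intro continuous_intros)
      show "(\<lambda>t. max c (min d t)) ` {a..b} \<subseteq> {c..d}" using assms(3) by auto
    qed
    obtain B where B: "\<And>t. t \<in> {c<..<d} \<Longrightarrow> \<bar>g t\<bar> \<le> B"
      using assms(1) unfolding pw_deriv_def bounded_iff by (metis imageI real_norm_def)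
    have "\<bar>?g t\<bar> \<le> max 0 B" for t using B[of t] by auto
    then show "bounded (?g ` {a<..<b})" by (intro boundedI[of _ "max 0 B"]) fastforce
    have "continuous_on (({c<..<d} - S) \<union> ?O) ?g"
    proof (rule continuous_on_open_Un)
      show "continuous_on ({c<..<d} - S) ?g"
        using S(3) by (rule continuous_on_eq) auto
      show "continuous_on ?O ?g"
        by (rule continuous_on_eq[OF continuous_on_const[of _ 0]]) auto
      show "open ({c<..<d} - S)" using S by (intro open_Diff finite_imp_closed) auto
    qed auto
    then show "continuous_on ({a<..<b} - (S \<union> {c, d})) ?g"
      by (rule continuous_on_subset) auto
    fix t assume t: "t \<in> {a<..<b} - (S \<union> {c, d})"
    consider "t < c" | "c < t" "t < d" | "d < t" using t by force
    then show "(?u has_real_derivative ?g t) (at t)"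
    proof cases
      case 1
      have "((\<lambda>_. u c) has_real_derivative ?g t) (at t)" using 1 by simp
      then show ?thesis
        by (rule has_field_derivative_transform_within_open[of _ _ _ "{..<c}"])
          (use 1 assms in \<open>auto simp: max_def min_def\<close>)
    next
      case 2
      then have "(u has_real_derivative ?g t) (at t)" using t S by auto
      then show ?thesis
        by (rule has_field_derivative_transform_within_open[of _ _ _ "{c<..<d}"]) (use 2 in auto)
    next
      case 3
      have "((\<lambda>_. u d) has_real_derivative ?g t) (at t)" using 3 by simp
      then show ?thesis
        by (rule has_field_derivative_transform_within_open[of _ _ _ "{d<..}"])
          (use 3 assms in \<open>auto simp: max_def min_def\<close>)
    qed
  qed (use S in simp)
qed

section \<open>Second-order initial value problems and Taylor estimates\<close>

definition Q1 :: "real \<Rightarrow> real" where "Q1 s = s / sqrt (1 + s\<^sup>2)"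
definition Q2 :: "real \<Rightarrow> real" where "Q2 s = 1 / sqrt (1 + s\<^sup>2) ^ 3"
definition Q3 :: "real \<Rightarrow> real" where "Q3 s = - 3 * s / sqrt (1 + s\<^sup>2) ^ 5"

lemma one_plus_square_pos: "0 < 1 + (s::real)\<^sup>2"
  by (simp add: add_pos_nonneg)

lemma DERIV_sqrt_one_plus_square:
  "((\<lambda>s::real. sqrt (1 + s\<^sup>2)) has_real_derivative s / sqrt (1 + s\<^sup>2)) (at s)"
  by (rule derivative_eq_intros refl | use one_plus_square_pos[of s] in \<open>simp add: field_simps\<close>)+

lemma DERIV_Q: "(Q has_real_derivative Q1 s) (at s)"
  unfolding Q_def Q1_def
  using DERIV_diff[OF DERIV_sqrt_one_plus_square DERIV_const] by simp

lemma DERIV_Q1: "(Q1 has_real_derivative Q2 s) (at s)"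
proof -
  define r where "r = sqrt (1 + s\<^sup>2)"
  have r: "r > 0" "r\<^sup>2 = 1 + s\<^sup>2" using one_plus_square_pos[of s] by (auto simp: r_def)
  have "((\<lambda>s. s / sqrt (1 + s\<^sup>2)) has_real_derivative (1 * r - s * (s / r)) / (r * r)) (at s)"
    unfolding r_def
    by (rule DERIV_divide DERIV_ident DERIV_sqrt_one_plus_square)+ (use r in \<open>simp add: r_def\<close>)
  moreover have "(1 * r - s * (s / r)) / (r * r) = (r\<^sup>2 - s\<^sup>2) / r ^ 3"
    using r(1) by (simp add: field_simps power2_eq_square power3_eq_cube)
  ultimately show ?thesis
    using r(2) unfolding Q1_def Q2_def r_def by simp
qed

lemma DERIV_Q2: "(Q2 has_real_derivative Q3 s) (at s)"
proof -
  define r where "r = sqrt (1 + s\<^sup>2)"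
  have r: "r > 0" using one_plus_square_pos[of s] by (auto simp: r_def)
  have "((\<lambda>s. sqrt (1 + s\<^sup>2) ^ 3) has_real_derivative 3 * r\<^sup>2 * (s / r)) (at s)"
    unfolding r_def using DERIV_power[OF DERIV_sqrt_one_plus_square[of s], of 3] by (simp add: mult_ac)
  then have "((\<lambda>s. 1 / sqrt (1 + s\<^sup>2) ^ 3) has_real_derivative
      (0 * r ^ 3 - 1 * (3 * r\<^sup>2 * (s / r))) / (r ^ 3 * r ^ 3)) (at s)"
    unfolding r_def
    by (intro DERIV_divide DERIV_const) (use r in \<open>simp_all add: r_def\<close>)
  moreover have "(0 * r ^ 3 - 1 * (3 * r\<^sup>2 * (s / r))) / (r ^ 3 * r ^ 3) = - 3 * s / r ^ 5"
    using r by (simp add: field_simps eval_nat_numeral)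
  ultimately show ?thesis
    unfolding Q2_def Q3_def r_def by simp
qed

lemma deriv_deriv_Q: "(deriv ^^ 2) Q = Q2"
proof -
  have "deriv Q = Q1" "deriv Q1 = Q2"
    using DERIV_Q DERIV_Q1 by (auto intro!: DERIV_imp_deriv)
  then show ?thesis by (simp add: eval_nat_numeral)
qed

lemma Q2_pos: "0 < Q2 s"
  using one_plus_square_pos[of s] by (simp add: Q2_def)

text \<open>With r = sqrt (1 + s^2) one has \<open>\<bar>s\<bar> \<le> r\<close> and, as r is at
  least 1, \<open>r \<le> r ^ 5\<close>. The bound is global, so the Taylor remainder of
  \<open>Q\<close> is controlled uniformly in the slope.\<close>

lemma Q3_bound: "\<bar>Q3 s\<bar> \<le> 3"
proof -
  define r where "r = sqrt (1 + s\<^sup>2)"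
  have r: "1 \<le> r" "\<bar>s\<bar> \<le> r" by (auto simp: r_def intro: real_le_rsqrt)
  have "\<bar>s\<bar> \<le> r ^ 1" using r by simp
  also have "r ^ 1 \<le> r ^ 5" using r by (intro power_increasing) auto
  finally show ?thesis
    using r unfolding Q3_def r_def[symmetric]
    by (simp add: abs_mult divide_le_eq)
qed

text \<open>Lagrange's form of the remainder; its factor 1/6 is simply estimated by 1.\<close>

lemma taylor2_bound:
  fixes f :: "real \<Rightarrow> real"
  assumes "\<And>t. lo \<le> t \<Longrightarrow> t \<le> hi \<Longrightarrow> (f has_real_derivative f1 t) (at t)"
    and "\<And>t. lo \<le> t \<Longrightarrow> t \<le> hi \<Longrightarrow> (f1 has_real_derivative f2 t) (at t)"
    and "\<And>t. lo \<le> t \<Longrightarrow> t \<le> hi \<Longrightarrow> (f2 has_real_derivative f3 t) (at t)"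
    and "\<And>t. lo \<le> t \<Longrightarrow> t \<le> hi \<Longrightarrow> \<bar>f3 t\<bar> \<le> C"
    and "lo \<le> x" "x \<le> hi" "lo \<le> y" "y \<le> hi"
  shows "\<bar>f y - (f x + f1 x * (y - x) + f2 x * (y - x)\<^sup>2 / 2)\<bar> \<le> C * \<bar>y - x\<bar> ^ 3"
proof (cases "y = x")
  case False
  define D where "D = (\<lambda>m::nat. if m = 0 then f else if m = 1 then f1 else if m = 2 then f2 else f3)"
  have "\<forall>m t. m < 3 \<and> lo \<le> t \<and> t \<le> hi \<longrightarrow> (D m has_real_derivative D (Suc m) t) (at t)"
    using assms(1-3) by (auto simp: D_def less_Suc_eq numeral_3_eq_3 numeral_2_eq_2)
  then obtain t where t: "if y < x then y < t \<and> t < x else x < t \<and> t < y"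
    and e: "f y = (\<Sum>m<3. D m x / fact m * (y - x) ^ m) + D 3 t / fact 3 * (y - x) ^ 3"
    using Taylor[of 3 D f lo hi x y] assms(5-8) False by (auto simp: D_def)
  have "\<bar>f3 t\<bar> \<le> C" using t assms(4-8) by (auto split: if_splits)
  then have "\<bar>f3 t / 6 * (y - x) ^ 3\<bar> \<le> C * \<bar>y - x\<bar> ^ 3"
    unfolding abs_mult power_abs by (intro mult_right_mono) auto
  moreover have "f y - (f x + f1 x * (y - x) + f2 x * (y - x)\<^sup>2 / 2) = f3 t / 6 * (y - x) ^ 3"
    unfolding e by (simp add: D_def eval_nat_numeral fact_numeral)
  ultimately show ?thesis by simp
qed simp

section \<open>Uniqueness for second-order initial value problems\<close>

text \<open>A Gronwall argument for N = d^2 + d'^2. From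
  \<open>\<bar>N' s\<bar> \<le> M * N s\<close> it follows that exp(-M s) N does not increase to the
  right of \<open>t0\<close>, and exp(M s) N does not decrease to the left of it; both vanish at
  \<open>t0\<close>.\<close>

lemma zero_initial_data:
  fixes d d' d'' :: "real \<Rightarrow> real"
  assumes cont: "continuous_on {a..b} d" "continuous_on {a..b} d'"
    and deriv: "\<And>t. t \<in> {a<..<b} \<Longrightarrow> (d has_real_derivative d' t) (at t)"
      "\<And>t. t \<in> {a<..<b} \<Longrightarrow> (d' has_real_derivative d'' t) (at t)"
    and bound: "\<And>t. t \<in> {a<..<b} \<Longrightarrow> \<bar>d'' t\<bar> \<le> K * (\<bar>d t\<bar> + \<bar>d' t\<bar>)" and "K \<ge> 0"
    and t0: "t0 \<in> {a..b}" "d t0 = 0" "d' t0 = 0"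
    and t: "t \<in> {a..b}"
  shows "d t = 0 \<and> d' t = 0"
proof -
  define N where "N = (\<lambda>t. (d t)\<^sup>2 + (d' t)\<^sup>2)"
  define N' where "N' = (\<lambda>t. 2 * d t * d' t + 2 * d' t * d'' t)"
  \<comment> \<open>The 1 bounds 2 d d' by N. The term 2 d' d'' contributes K N through its mixed
    part and at most 2 K N through 2 K d'^2.\<close>
  define M where "M = 1 + 3 * K"
  have N: "(N has_real_derivative N' s) (at s)" if "s \<in> {a<..<b}" for s
    unfolding N_def N'_def using deriv[OF that]
    by (auto intro!: derivative_eq_intros simp: field_simps)
  have cN: "continuous_on {a..b} N" unfolding N_def using cont by (intro continuous_intros)
  have N'M: "\<bar>N' s\<bar> \<le> M * N s" if "s \<in> {a<..<b}" for s
  proof -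
    let ?x = "\<bar>d s\<bar>" and ?y = "\<bar>d' s\<bar>"
    have 1: "2 * ?x * ?y \<le> N s"
      using zero_le_power2[of "?x - ?y"] by (simp add: N_def power2_diff)
    have "\<bar>N' s\<bar> \<le> 2 * ?x * ?y + 2 * ?y * \<bar>d'' s\<bar>"
      unfolding N'_def by (rule order_trans[OF abs_triangle_ineq]) (simp add: abs_mult)
    also have "\<dots> \<le> 2 * ?x * ?y + 2 * ?y * (K * (?x + ?y))"
      using bound[OF that] by (intro add_left_mono mult_left_mono) auto
    also have "\<dots> = 2 * ?x * ?y + K * (2 * ?x * ?y) + K * (2 * ?y\<^sup>2)"
      by (simp add: algebra_simps power2_eq_square)
    also have "\<dots> \<le> N s + K * N s + K * (2 * N s)"
      using 1 \<open>K \<ge> 0\<close> by (intro add_mono mult_left_mono) (auto simp: N_def)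
    finally show ?thesis by (simp add: M_def algebra_simps)
  qed
  have N0: "N t0 = 0" using t0 by (simp add: N_def)
  have "N t \<le> 0"
  proof (cases "t0 \<le> t")
    case True
    have "- (exp (- M * t0) * N t0) \<le> - (exp (- M * t) * N t)"
    proof (rule DERIV_nonneg_imp_increasing_open[OF True])
      show "continuous_on {t0..t} (\<lambda>s. - (exp (- M * s) * N s))"
        by (intro continuous_intros continuous_on_subset[OF cN]) (use t t0 in auto)
      fix s assume "t0 < s" "s < t"
      then have s: "s \<in> {a<..<b}" using t t0 by auto
      have "((\<lambda>s. - (exp (- M * s) * N s)) has_real_derivative exp (- M * s) * (M * N s - N' s)) (at s)"
        by (auto intro!: derivative_eq_intros N[OF s] simp: algebra_simps)
      moreover have "0 \<le> exp (- M * s) * (M * N s - N' s)"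
        using N'M[OF s] by (intro mult_nonneg_nonneg) auto
      ultimately show "\<exists>y. ((\<lambda>s. - (exp (- M * s) * N s)) has_real_derivative y) (at s) \<and> 0 \<le> y"
        by blast
    qed
    then show ?thesis by (simp add: N0 mult_le_0_iff)
  next
    case False
    then have le: "t \<le> t0" by simp
    have "exp (M * t) * N t \<le> exp (M * t0) * N t0"
    proof (rule DERIV_nonneg_imp_increasing_open[OF le])
      show "continuous_on {t..t0} (\<lambda>s. exp (M * s) * N s)"
        by (intro continuous_intros continuous_on_subset[OF cN]) (use t t0 in auto)
      fix s assume "t < s" "s < t0"
      then have s: "s \<in> {a<..<b}" using t t0 by auto
      have "((\<lambda>s. exp (M * s) * N s) has_real_derivative exp (M * s) * (M * N s + N' s)) (at s)"
        by (auto intro!: derivative_eq_intros N[OF s] simp: algebra_simps)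
      moreover have "0 \<le> exp (M * s) * (M * N s + N' s)"
        using N'M[OF s] by (intro mult_nonneg_nonneg) auto
      ultimately show "\<exists>y. ((\<lambda>s. exp (M * s) * N s) has_real_derivative y) (at s) \<and> 0 \<le> y"
        by blast
    qed
    then show ?thesis by (simp add: N0 mult_le_0_iff)
  qed
  then show ?thesis unfolding N_def by (simp add: sum_power2_le_zero_iff)
qed

lemma Lipschitz_on_Icc:
  fixes f f' :: "real \<Rightarrow> real"
  assumes "\<And>t. t \<in> {lo..hi} \<Longrightarrow> (f has_real_derivative f' t) (at t)"
    and "continuous_on {lo..hi} f'"
  obtains K where "K \<ge> 0" "\<And>x y. x \<in> {lo..hi} \<Longrightarrow> y \<in> {lo..hi} \<Longrightarrow> \<bar>f x - f y\<bar> \<le> K * \<bar>x - y\<bar>"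
proof -
  have "bounded (f' ` {lo..hi})"
    using assms(2) by (intro compact_imp_bounded compact_continuous_image) auto
  then obtain K where K: "\<And>t. t \<in> {lo..hi} \<Longrightarrow> \<bar>f' t\<bar> \<le> K"
    unfolding bounded_iff by (metis imageI real_norm_def)
  show thesis
  proof (rule that[of "max 0 K"])
    fix x y assume xy: "x \<in> {lo..hi}" "y \<in> {lo..hi}"
    have "norm (f x - f y) \<le> max 0 K * norm (x - y)"
    proof (rule field_differentiable_bound[OF convex_real_interval(5)])
      fix t assume t: "t \<in> {lo..hi}"
      show "(f has_field_derivative f' t) (at t within {lo..hi})"
        using assms(1)[OF t] by (rule has_field_derivative_at_within)
      show "norm (f' t) \<le> max 0 K" using K[OF t] by auto
    qed (use xy in auto)
    then show "\<bar>f x - f y\<bar> \<le> max 0 K * \<bar>x - y\<bar>" by simp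
  qed simp
qed

text \<open>The right-hand side is a product because the Euler-Lagrange equation, solved for the
  second derivative, is F'(z) - \<sigma> times a function of the slope. Both trajectories and their
  slopes stay in compact intervals, where \<open>f\<close> and \<open>R\<close> are bounded and
  Lipschitz; hence the difference of the solutions satisfies the linear inequality of
  \<open>zero_initial_data\<close>.\<close>

lemma autonomous_ode_unique:
  fixes f f' R R' x x' y y' :: "real \<Rightarrow> real"
  assumes f: "\<And>t. t \<in> {lo..hi} \<Longrightarrow> (f has_real_derivative f' t) (at t)" "continuous_on {lo..hi} f'"
    and R: "\<And>t. (R has_real_derivative R' t) (at t)" "continuous_on UNIV R'"
    and x: "continuous_on {a..b} x" "continuous_on {a..b} x'" "\<And>t. t \<in> {a..b} \<Longrightarrow> x t \<in> {lo..hi}"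
      "\<And>t. t \<in> {a<..<b} \<Longrightarrow> (x has_real_derivative x' t) (at t)"
      "\<And>t. t \<in> {a<..<b} \<Longrightarrow> (x' has_real_derivative f (x t) * R (x' t)) (at t)"
    and y: "continuous_on {a..b} y" "continuous_on {a..b} y'" "\<And>t. t \<in> {a..b} \<Longrightarrow> y t \<in> {lo..hi}"
      "\<And>t. t \<in> {a<..<b} \<Longrightarrow> (y has_real_derivative y' t) (at t)"
      "\<And>t. t \<in> {a<..<b} \<Longrightarrow> (y' has_real_derivative f (y t) * R (y' t)) (at t)"
    and t0: "t0 \<in> {a..b}" "x t0 = y t0" "x' t0 = y' t0"
    and t: "t \<in> {a..b}"
  shows "x t = y t \<and> x' t = y' t"
proof -
  have "bounded (x' ` {a..b})" "bounded (y' ` {a..b})"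
    using x y by (auto intro!: compact_imp_bounded compact_continuous_image)
  then obtain V1 V2 where V: "\<And>t. t \<in> {a..b} \<Longrightarrow> \<bar>x' t\<bar> \<le> V1" "\<And>t. t \<in> {a..b} \<Longrightarrow> \<bar>y' t\<bar> \<le> V2"
    unfolding bounded_iff by (metis imageI real_norm_def)
  define V where "V = max V1 V2"
  have xV: "x' t \<in> {-V..V}" and yV: "y' t \<in> {-V..V}" if "t \<in> {a..b}" for t
    using V[OF that] by (auto simp: V_def)
  obtain K1 where K1: "K1 \<ge> 0" "\<And>x y. x \<in> {lo..hi} \<Longrightarrow> y \<in> {lo..hi} \<Longrightarrow> \<bar>f x - f y\<bar> \<le> K1 * \<bar>x - y\<bar>"
    using Lipschitz_on_Icc[OF f] by blast
  obtain K2 where K2: "K2 \<ge> 0" "\<And>x y. x \<in> {-V..V} \<Longrightarrow> y \<in> {-V..V} \<Longrightarrow> \<bar>R x - R y\<bar> \<le> K2 * \<bar>x - y\<bar>"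
    using Lipschitz_on_Icc[of "-V" V R R'] R by (metis continuous_on_subset subset_UNIV)
  have "bounded (f ` {lo..hi})" "bounded (R ` {-V..V})"
    using DERIV_isCont[OF f(1)] DERIV_isCont[OF R(1)]
    by (intro compact_imp_bounded compact_continuous_image continuous_at_imp_continuous_on ballI; simp)+
  then obtain B1 B2 where B: "\<And>t. t \<in> {lo..hi} \<Longrightarrow> \<bar>f t\<bar> \<le> B1" "\<And>t. t \<in> {-V..V} \<Longrightarrow> \<bar>R t\<bar> \<le> B2"
    unfolding bounded_iff by (metis imageI real_norm_def)
  have B0: "0 \<le> B1" "0 \<le> B2"
    using B(1)[OF x(3)[OF t]] B(2)[OF xV[OF t]] by linarith+
  have "x t - y t = 0 \<and> x' t - y' t = 0"
  \<comment> \<open>The constant comes from splitting the difference of products as (f x - f y) R +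
    f (R - R): one Lipschitz constant times the bound of the other factor, in each term.\<close>
  proof (rule zero_initial_data[where K = "K1 * B2 + B1 * K2" and
        d'' = "\<lambda>t. f (x t) * R (x' t) - f (y t) * R (y' t)", OF _ _ _ _ _ _ t0(1) _ _ t])
    fix s assume s: "s \<in> {a<..<b}"
    then have s': "s \<in> {a..b}" by auto
    have "\<bar>f (x s) * R (x' s) - f (y s) * R (y' s)\<bar> =
        \<bar>(f (x s) - f (y s)) * R (x' s) + f (y s) * (R (x' s) - R (y' s))\<bar>"
      by (simp add: algebra_simps)
    also have "\<dots> \<le> \<bar>f (x s) - f (y s)\<bar> * \<bar>R (x' s)\<bar> + \<bar>f (y s)\<bar> * \<bar>R (x' s) - R (y' s)\<bar>"
      unfolding abs_mult[symmetric] by (rule abs_triangle_ineq)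
    also have "\<dots> \<le> (K1 * \<bar>x s - y s\<bar>) * B2 + B1 * (K2 * \<bar>x' s - y' s\<bar>)"
      using K1 K2 B B0 x(3)[OF s'] y(3)[OF s'] xV[OF s'] yV[OF s']
      by (intro add_mono mult_mono) auto
    also have "\<dots> \<le> (K1 * B2 + B1 * K2) * (\<bar>x s - y s\<bar> + \<bar>x' s - y' s\<bar>)"
      using K1(1) K2(1) B0 by (simp add: algebra_simps)
    finally show "\<bar>f (x s) * R (x' s) - f (y s) * R (y' s)\<bar>
        \<le> (K1 * B2 + B1 * K2) * (\<bar>x s - y s\<bar> + \<bar>x' s - y' s\<bar>)" .
  next
    show "continuous_on {a..b} (\<lambda>t. x t - y t)" "continuous_on {a..b} (\<lambda>t. x' t - y' t)"
      using x y by (intro continuous_intros; simp)+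
  qed (use x y t0 K1 K2 B0 in \<open>auto intro!: DERIV_diff\<close>)
  then show ?thesis by simp
qed

section \<open>Second variation of the energy\<close>

text \<open>Along z + s \<phi> the energy, up to the factor \<epsilon>, changes by at most s^2 (J/2
  + s C 2L), where J is the second variation and C bounds the cubic Taylor remainder pointwise. For
  small s > 0 this is negative, while the mean and positivity are preserved.\<close>

lemma not_local_minimizer_of_second_variation:
  fixes F F1 F2 F3 z g \<phi> h :: "real \<Rightarrow> real" and \<epsilon> :: real
  defines "L \<equiv> inverse \<epsilon>"
  assumes \<epsilon>: "\<epsilon> > 0"
    and z: "pw_deriv (- L) L z g" "\<And>t. t \<in> {- L..L} \<Longrightarrow> 0 < z t"
    and \<phi>: "pw_deriv (- L) L \<phi> h"
    and F: "\<And>x. x > 0 \<Longrightarrow> (F has_real_derivative F1 x) (at x)"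
      "\<And>x. x > 0 \<Longrightarrow> (F1 has_real_derivative F2 x) (at x)"
      "\<And>x. x > 0 \<Longrightarrow> (F2 has_real_derivative F3 x) (at x)"
      "continuous_on {0<..} F3"
    and mean: "(\<integral>t. \<phi> t \<partial>lebesgue_on {- L<..<L}) = 0"
    and iQ: "integrable (lebesgue_on {- L<..<L}) (\<lambda>t. Q1 (\<epsilon> * g t) / \<epsilon> * h t + F1 (z t) * \<phi> t)"
    and first: "(\<integral>t. Q1 (\<epsilon> * g t) / \<epsilon> * h t + F1 (z t) * \<phi> t \<partial>lebesgue_on {- L<..<L}) = 0"
    and second: "(\<integral>t. Q2 (\<epsilon> * g t) * (h t)\<^sup>2 + F2 (z t) * (\<phi> t)\<^sup>2 \<partial>lebesgue_on {- L<..<L}) < 0"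
  shows "\<not> local_minimizer F \<epsilon> r z"
proof
  let ?I = "{- L<..<L}" and ?M = "lebesgue_on {- L<..<L}"
  assume "local_minimizer F \<epsilon> r z"
  then obtain \<delta> where adm: "z \<in> admissible \<epsilon> r" and "\<delta> > 0"
    and min: "\<And>y. y \<in> admissible \<epsilon> r \<Longrightarrow> H1_norm (- L) L (\<lambda>t. y t - z t) < \<delta> \<Longrightarrow> energy F \<epsilon> z \<le> energy F \<epsilon> y"
    unfolding local_minimizer_def L_def by blast
  have L: "0 < L" "- L \<le> L" using \<epsilon> by (auto simp: L_def)
  have cz: "continuous_on {- L..L} z" and c\<phi>: "continuous_on {- L..L} \<phi>"
    using z \<phi> by (auto simp: pw_deriv_def)
  have "\<exists>t0\<in>{- L..L}. \<forall>t\<in>{- L..L}. z t0 \<le> z t"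
    using L by (intro continuous_attains_inf cz) auto
  then obtain t0 where t0: "t0 \<in> {- L..L}" "\<And>t. t \<in> {- L..L} \<Longrightarrow> z t0 \<le> z t" by blast
  \<comment> \<open>Half the minimum of \<open>z\<close>: a perturbation of size at most
    \<open>lo\<close> then keeps the competitor inside \<open>{lo..hi + lo}\<close>, a compact part
    of the domain of \<open>F\<close>.\<close>
  define lo where "lo = z t0 / 2"
  have lo: "0 < lo" "\<And>t. t \<in> {- L..L} \<Longrightarrow> 2 * lo \<le> z t"
    using t0 z(2) by (auto simp: lo_def)
  have bdd: "\<exists>C>0. \<forall>t\<in>S. \<bar>f t\<bar> \<le> C" if "bounded (f ` S)" for f :: "real \<Rightarrow> real" and S
    using that unfolding bounded_pos by (metis imageI real_norm_def)
  have bddc: "\<exists>C>0. \<forall>t\<in>{a..b}. \<bar>f t\<bar> \<le> C" if "continuous_on {a..b} f" for f :: "real \<Rightarrow> real" and a b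
    using that by (intro bdd compact_imp_bounded compact_continuous_image) auto
  obtain hi where hi: "hi > 0" "\<And>t. t \<in> {- L..L} \<Longrightarrow> \<bar>z t\<bar> \<le> hi" using bddc[OF cz] by blast
  obtain C1 where C1: "C1 > 0" "\<And>t. t \<in> {- L..L} \<Longrightarrow> \<bar>\<phi> t\<bar> \<le> C1" using bddc[OF c\<phi>] by blast
  obtain C2 where C2: "C2 > 0" "\<And>t. t \<in> ?I \<Longrightarrow> \<bar>h t\<bar> \<le> C2"
    using bdd[of h ?I] \<phi> unfolding pw_deriv_def by blast
  obtain C3 where C3: "C3 > 0" "\<And>t. t \<in> {lo..hi + lo} \<Longrightarrow> \<bar>F3 t\<bar> \<le> C3"
    using bddc[of lo "hi + lo" F3] F(4) lo(1) by (metis atLeast_iff continuous_on_subset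
        greaterThan_iff order_less_le_trans atLeastAtMost_iff subsetI)
  \<comment> \<open>Dividing the remainder 3 (\<epsilon> s C2)^3 of \<open>Q\<close> by \<epsilon>^2
    leaves 3 \<epsilon> C2^3 s^3; the remainder of \<open>F\<close> contributes C3 C1^3 s^3.\<close>
  define C where "C = 3 * \<epsilon> * C2 ^ 3 + C3 * C1 ^ 3"
  have C: "C > 0" using \<epsilon> C1 C2 C3 by (auto simp: C_def intro!: add_pos_pos mult_pos_pos)

  \<comment> \<open>A non-integrable function has integral 0 by convention, so a strictly negative
    integral already forces integrability.\<close>
  have iQ2: "integrable ?M (\<lambda>t. Q2 (\<epsilon> * g t) * (h t)\<^sup>2 + F2 (z t) * (\<phi> t)\<^sup>2)"
    using second by (rule contrapos_pp) (simp add: not_integrable_integral_eq)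
  define J where "J = (\<integral>t. Q2 (\<epsilon> * g t) * (h t)\<^sup>2 + F2 (z t) * (\<phi> t)\<^sup>2 \<partial>?M)"
  have J: "J < 0" using second by (simp add: J_def)

  have energy_integrable: "integrable ?M (\<lambda>t. Q (\<epsilon> * k t) / \<epsilon>\<^sup>2 + F (y t))"
    if y: "pw_deriv (- L) L y k" "\<And>t. t \<in> {- L..L} \<Longrightarrow> 0 < y t" for y k
  proof -
    have "continuous_on {0<..} F"
      using DERIV_isCont[OF F(1)] by (intro continuous_at_imp_continuous_on) auto
    moreover have "continuous_on {- L..L} y" using y(1) by (simp add: pw_deriv_def)
    ultimately have "continuous_on {- L..L} (\<lambda>t. F (y t))"
      by (rule continuous_on_compose2) (use y(2) in auto)
    then have "integrable ?M (\<lambda>t. F (y t))"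
      by (intro integrable_bounded_image continuous_on_Icc_measurable bounded_continuous_image)
    moreover have "integrable ?M (\<lambda>t. Q (\<epsilon> * k t) / \<epsilon>\<^sup>2)"
    proof -
      have Q: "isCont Q s" for s by (rule DERIV_isCont[OF DERIV_Q])
      have [measurable]: "k \<in> borel_measurable ?M" by (rule pw_deriv_measurable[OF y(1)])
      have [measurable]: "Q \<in> borel_measurable borel"
        using Q by (intro borel_measurable_continuous_onI continuous_at_imp_continuous_on) auto
      obtain B where B: "\<And>t. t \<in> ?I \<Longrightarrow> \<bar>k t\<bar> \<le> B"
        using bdd[of k ?I] y(1) unfolding pw_deriv_def by blast
      obtain B' where B': "\<And>s. s \<in> {- (\<epsilon> * B)..\<epsilon> * B} \<Longrightarrow> \<bar>Q s\<bar> \<le> B'"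
        using bddc[of "- (\<epsilon> * B)" "\<epsilon> * B" Q] Q by (metis continuous_at_imp_continuous_on)
      show ?thesis
      proof (rule integrable_bounded_interval)
        show "(\<lambda>t. Q (\<epsilon> * k t) / \<epsilon>\<^sup>2) \<in> borel_measurable ?M" by measurable
        fix t assume t: "t \<in> ?I"
        have "\<bar>\<epsilon> * k t\<bar> \<le> \<epsilon> * B" using B[OF t] \<epsilon> by (simp add: abs_mult)
        then have "\<bar>Q (\<epsilon> * k t)\<bar> \<le> B'" by (intro B') auto
        then show "\<bar>Q (\<epsilon> * k t) / \<epsilon>\<^sup>2\<bar> \<le> B' / \<epsilon>\<^sup>2" by (simp add: divide_right_mono)
      qed
    qed
    ultimately show ?thesis by simp
  qed

  define N where "N = sqrt ((\<integral>t. (\<phi> t)\<^sup>2 \<partial>?M) + (\<integral>t. (h t)\<^sup>2 \<partial>?M))"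
  have ev: "\<forall>\<^sub>F s in at_right 0. s * K < c" if "0 < c" for K c :: real
  proof -
    have "((\<lambda>s. s * K) \<longlongrightarrow> 0 * K) (at_right 0)" by (intro tendsto_intros)
    then show ?thesis using that by (auto dest: order_tendstoD)
  qed
  \<comment> \<open>The conditions make the competitor stay above \<open>lo\<close>, lie within
    distance \<delta> of \<open>z\<close>, and have a cubic remainder too small to offset the
    negative quadratic term.\<close>
  have "\<forall>\<^sub>F s in at_right 0. 0 < s \<and> s * C1 < lo \<and> s * N < \<delta> \<and> s * (C * (2 * L)) < - J / 2"
    using lo \<open>\<delta> > 0\<close> J by (intro eventually_conj eventually_at_right_less ev) auto
  then obtain s where s: "0 < s" "s * C1 < lo" "s * N < \<delta>" "s * (C * (2 * L)) < - J / 2"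
    using eventually_happens'[OF trivial_limit_at_right_real] by blast

  let ?y = "\<lambda>t. z t + s * \<phi> t" and ?k = "\<lambda>t. g t + s * h t"
  have pwy: "pw_deriv (- L) L ?y ?k" using z \<phi> by (intro pw_deriv_add pw_deriv_cmult)
  have sphi: "\<bar>s * \<phi> t\<bar> \<le> lo" if "t \<in> {- L..L}" for t
  proof -
    have "\<bar>s * \<phi> t\<bar> \<le> s * C1" unfolding abs_mult using C1(2)[OF that] s by simp
    then show ?thesis using s by simp
  qed
  have ylo: "lo \<le> ?y t" "?y t \<le> hi + lo" if "t \<in> {- L..L}" for t
    using sphi[OF that] lo(2)[OF that] hi(2)[OF that] lo(1) by linarith+
  have ypos: "0 < ?y t" if "t \<in> {- L..L}" for t using ylo[OF that] lo by simp
  have iz: "integrable ?M z" and i\<phi>: "integrable ?M \<phi>"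
    using cz c\<phi> by (auto intro!: integrable_bounded_image continuous_on_Icc_measurable bounded_continuous_image)
  have "?y \<in> admissible \<epsilon> r"
  proof -
    have "(\<integral>t. ?y t \<partial>?M) = 2 * r * inverse \<epsilon>"
      using adm iz i\<phi> mean unfolding admissible_def L_def[symmetric] by simp
    moreover have "AE t in ?M. 0 < ?y t" using ypos by (intro AE_I2) auto
    ultimately show ?thesis
      using pw_deriv_H1[OF L(2) pwy] unfolding admissible_def L_def[symmetric] by simp
  qed
  moreover have "H1_norm (- L) L (\<lambda>t. ?y t - z t) < \<delta>"
  proof -
    have "pw_deriv (- L) L (\<lambda>t. ?y t - z t) (\<lambda>t. s * h t)"
      using pw_deriv_cmult[OF \<phi>] by simp
    then have "H1_norm (- L) L (\<lambda>t. ?y t - z t) =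
        sqrt ((\<integral>t. (?y t - z t)\<^sup>2 \<partial>?M) + (\<integral>t. (s * h t)\<^sup>2 \<partial>?M))"
      by (intro H1_norm_eq pw_deriv_weak_deriv L)
    also have "\<dots> = sqrt (s\<^sup>2 * ((\<integral>t. (\<phi> t)\<^sup>2 \<partial>?M) + (\<integral>t. (h t)\<^sup>2 \<partial>?M)))"
      by (simp add: power_mult_distrib algebra_simps)
    also have "\<dots> = s * N" using s by (simp add: N_def real_sqrt_mult)
    finally show ?thesis using s by simp
  qed
  ultimately have "energy F \<epsilon> z \<le> energy F \<epsilon> ?y" by (rule min)
  \<comment> \<open>Both energies are finite, so the extended real inequality becomes one between
    integrals after cancelling \<epsilon> > 0.\<close>
  then have le: "(\<integral>t. Q (\<epsilon> * g t) / \<epsilon>\<^sup>2 + F (z t) \<partial>?M) \<le> (\<integral>t. Q (\<epsilon> * ?k t) / \<epsilon>\<^sup>2 + F (?y t) \<partial>?M)"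
    using energy_eq[of \<epsilon> z g F] energy_eq[of \<epsilon> ?y ?k F] \<epsilon>
      pw_deriv_weak_deriv[OF L(2) z(1)] pw_deriv_weak_deriv[OF L(2) pwy]
      energy_integrable[OF z] energy_integrable[OF pwy ypos]
    by (simp add: L_def)

  let ?E1 = "\<lambda>t. Q1 (\<epsilon> * g t) / \<epsilon> * h t + F1 (z t) * \<phi> t"
  let ?E2 = "\<lambda>t. Q2 (\<epsilon> * g t) * (h t)\<^sup>2 + F2 (z t) * (\<phi> t)\<^sup>2"
  have expand: "Q (\<epsilon> * ?k t) / \<epsilon>\<^sup>2 + F (?y t) \<le>
      Q (\<epsilon> * g t) / \<epsilon>\<^sup>2 + F (z t) + s * ?E1 t + s\<^sup>2 / 2 * ?E2 t + s ^ 3 * C" if t: "t \<in> ?I" for t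
  proof -
    have t': "t \<in> {- L..L}" using t by auto
    have "\<bar>Q (\<epsilon> * ?k t) - (Q (\<epsilon> * g t) + Q1 (\<epsilon> * g t) * (\<epsilon> * ?k t - \<epsilon> * g t) +
        Q2 (\<epsilon> * g t) * (\<epsilon> * ?k t - \<epsilon> * g t)\<^sup>2 / 2)\<bar> \<le> 3 * \<bar>\<epsilon> * ?k t - \<epsilon> * g t\<bar> ^ 3"
      by (rule taylor2_bound[where lo = "min (\<epsilon> * ?k t) (\<epsilon> * g t)" and hi = "max (\<epsilon> * ?k t) (\<epsilon> * g t)"
            and ?f3.0 = Q3]) (auto intro: DERIV_Q DERIV_Q1 DERIV_Q2 Q3_bound)
    moreover have "\<epsilon> * ?k t - \<epsilon> * g t = \<epsilon> * s * h t" by (simp add: algebra_simps)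
    moreover have "\<bar>\<epsilon> * s * h t\<bar> ^ 3 \<le> (\<epsilon> * s * C2) ^ 3"
      using C2(2)[OF t] \<epsilon> s by (intro power_mono) (auto simp: abs_mult)
    ultimately have "Q (\<epsilon> * ?k t) \<le> Q (\<epsilon> * g t) + Q1 (\<epsilon> * g t) * (\<epsilon> * s * h t) +
        Q2 (\<epsilon> * g t) * (\<epsilon> * s * h t)\<^sup>2 / 2 + 3 * (\<epsilon> * s * C2) ^ 3"
      by (smt (verit))
    then have "Q (\<epsilon> * ?k t) / \<epsilon>\<^sup>2 \<le> (Q (\<epsilon> * g t) + Q1 (\<epsilon> * g t) * (\<epsilon> * s * h t) +
        Q2 (\<epsilon> * g t) * (\<epsilon> * s * h t)\<^sup>2 / 2 + 3 * (\<epsilon> * s * C2) ^ 3) / \<epsilon>\<^sup>2"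
      by (rule divide_right_mono) simp
    also have "\<dots> = Q (\<epsilon> * g t) / \<epsilon>\<^sup>2 + s * (Q1 (\<epsilon> * g t) / \<epsilon> * h t) + s\<^sup>2 / 2 * (Q2 (\<epsilon> * g t) * (h t)\<^sup>2)
        + s ^ 3 * (3 * \<epsilon> * C2 ^ 3)"
      using \<epsilon> by (simp add: field_simps power2_eq_square power3_eq_cube)
    finally have 1: "Q (\<epsilon> * ?k t) / \<epsilon>\<^sup>2 \<le> Q (\<epsilon> * g t) / \<epsilon>\<^sup>2 + s * (Q1 (\<epsilon> * g t) / \<epsilon> * h t) +
        s\<^sup>2 / 2 * (Q2 (\<epsilon> * g t) * (h t)\<^sup>2) + s ^ 3 * (3 * \<epsilon> * C2 ^ 3)" .
    have "\<bar>F (?y t) - (F (z t) + F1 (z t) * (?y t - z t) + F2 (z t) * (?y t - z t)\<^sup>2 / 2)\<bar>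
        \<le> C3 * \<bar>?y t - z t\<bar> ^ 3"
      by (rule taylor2_bound[where lo = lo and hi = "hi + lo" and ?f3.0 = F3])
        (use lo(1) lo(2)[OF t'] hi(2)[OF t'] ylo[OF t'] in \<open>auto intro!: F C3\<close>)
    moreover have "\<bar>?y t - z t\<bar> ^ 3 \<le> (s * C1) ^ 3"
      using C1(2)[OF t'] s by (intro power_mono) (auto simp: abs_mult)
    then have "C3 * \<bar>?y t - z t\<bar> ^ 3 \<le> C3 * (s * C1) ^ 3"
      using C3 by (intro mult_left_mono) auto
    moreover have "?y t - z t = s * \<phi> t" by simp
    ultimately have "F (?y t) \<le> F (z t) + F1 (z t) * (s * \<phi> t) + F2 (z t) * (s * \<phi> t)\<^sup>2 / 2 + C3 * (s * C1) ^ 3"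
      by (smt (verit))
    also have "\<dots> = F (z t) + s * (F1 (z t) * \<phi> t) + s\<^sup>2 / 2 * (F2 (z t) * (\<phi> t)\<^sup>2) + s ^ 3 * (C3 * C1 ^ 3)"
      by (simp add: power_mult_distrib algebra_simps)
    finally show ?thesis using 1 by (simp add: C_def algebra_simps)
  qed
  interpret finite_measure ?M by (rule finite_measure_lebesgue_on) simp
  have i0: "integrable ?M (\<lambda>t. Q (\<epsilon> * g t) / \<epsilon>\<^sup>2 + F (z t))" by (rule energy_integrable[OF z])
  have "(\<integral>t. Q (\<epsilon> * ?k t) / \<epsilon>\<^sup>2 + F (?y t) \<partial>?M) \<le>
      (\<integral>t. (Q (\<epsilon> * g t) / \<epsilon>\<^sup>2 + F (z t)) + s * ?E1 t + s\<^sup>2 / 2 * ?E2 t + s ^ 3 * C \<partial>?M)"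
    using expand by (intro integral_mono energy_integrable[OF pwy ypos] Bochner_Integration.integrable_add
        integrable_mult_right i0 iQ iQ2) auto
  also have "\<dots> = (\<integral>t. Q (\<epsilon> * g t) / \<epsilon>\<^sup>2 + F (z t) \<partial>?M) + s * (\<integral>t. ?E1 t \<partial>?M) + s\<^sup>2 / 2 * J
      + s ^ 3 * C * (2 * L)"
  proof -
    have "measure ?M (space ?M) = 2 * L" using L by (simp add: measure_restrict_space)
    then show ?thesis
      using i0 iQ iQ2 unfolding J_def
      by (subst Bochner_Integration.integral_add Bochner_Integration.integral_mult_right; simp)+
  qed
  also have "\<dots> = (\<integral>t. Q (\<epsilon> * g t) / \<epsilon>\<^sup>2 + F (z t) \<partial>?M) + s\<^sup>2 * (J / 2 + s * (C * (2 * L)))"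
    using first by (simp add: algebra_simps power2_eq_square power3_eq_cube)
  also have "\<dots> < (\<integral>t. Q (\<epsilon> * g t) / \<epsilon>\<^sup>2 + F (z t) \<partial>?M)"
    using s by (simp add: mult_pos_neg)
  finally show False using le by simp
qed

section \<open>Reflection symmetry and the destabilizing variation\<close>

lemma ode_nonmonotone_not_local_minimizer:
  fixes F F1 F2 F3 z z' z'' :: "real \<Rightarrow> real" and \<epsilon> \<sigma> r :: real
  defines "L \<equiv> inverse \<epsilon>"
  assumes \<epsilon>: "\<epsilon> > 0"
    and F: "\<And>x. x > 0 \<Longrightarrow> (F has_real_derivative F1 x) (at x)"
      "\<And>x. x > 0 \<Longrightarrow> (F1 has_real_derivative F2 x) (at x)"
      "\<And>x. x > 0 \<Longrightarrow> (F2 has_real_derivative F3 x) (at x)"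
      "continuous_on {0<..} F3"
    and pos: "\<And>t. t \<in> {- L..L} \<Longrightarrow> 0 < z t"
    and z: "\<And>t. t \<in> {- L..L} \<Longrightarrow> (z has_real_derivative z' t) (at t within {- L..L})"
    and cz': "continuous_on {- L..L} z'"
    and z': "\<And>t. t \<in> {- L<..<L} \<Longrightarrow> (z' has_real_derivative z'' t) (at t)"
    and eq: "\<And>t. t \<in> {- L<..<L} \<Longrightarrow> Q2 (\<epsilon> * z' t) * z'' t = F1 (z t) - \<sigma>"
    and bc: "z' (- L) = 0" "z' L = 0"
    and nonmono: "\<not> mono_on {- L..L} z" "\<not> antimono_on {- L..L} z"
  shows "\<not> local_minimizer F \<epsilon> r z"
proof -
  let ?I = "{- L<..<L}" and ?M = "lebesgue_on {- L<..<L}"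
  have L: "0 < L" "- L \<le> L" using \<epsilon> by (auto simp: L_def)
  have zI: "(z has_real_derivative z' t) (at t)" if "t \<in> ?I" for t
    using z[of t] that by (simp add: at_within_Icc_at)
  have pwz: "pw_deriv (- L) L z z'" by (rule pw_deriv_C1[OF z cz'])
  have cz: "continuous_on {- L..L} z" using pwz by (simp add: pw_deriv_def)
  have cF1: "continuous_on {0<..} F1" and cF2: "continuous_on {0<..} F2"
    using DERIV_isCont[OF F(2)] DERIV_isCont[OF F(3)] by (auto intro!: continuous_at_imp_continuous_on)
  define W where "W = (\<lambda>t. F1 (z t) - \<sigma>)"
  define W' where "W' = (\<lambda>t. F2 (z t) * z' t)"
  define R where "R = (\<lambda>v. sqrt (1 + (\<epsilon> * v)\<^sup>2) ^ 3)"
  \<comment> \<open>The second derivative, expressed through the equation. Unlike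
    \<open>z''\<close>, it is controlled up to the endpoints and visibly continuous on the closed
    interval, which the truncation argument uses.\<close>
  define zz where "zz = (\<lambda>t. W t * R (z' t))"
  have R: "Q2 (\<epsilon> * v) * R v = 1" for v
    using one_plus_square_pos[of "\<epsilon> * v"] by (simp add: Q2_def R_def)
  have Qzz: "Q2 (\<epsilon> * z' t) * zz t = W t" for t
    using R[of "z' t"] by (simp add: zz_def algebra_simps)
  have z'I: "(z' has_real_derivative zz t) (at t)" if t: "t \<in> ?I" for t
  proof -
    have "Q2 (\<epsilon> * z' t) * z'' t = Q2 (\<epsilon> * z' t) * zz t" using eq[OF t] Qzz[of t] by (simp add: W_def)
    then have "z'' t = zz t" using Q2_pos[of "\<epsilon> * z' t"] by simp
    then show ?thesis using z'[OF t] by simp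
  qed
  have W: "(W has_real_derivative W' t) (at t)" if "t \<in> ?I" for t
    unfolding W_def W'_def
    using DERIV_diff[OF DERIV_chain2[OF F(2)[OF pos] zI[OF that]] DERIV_const] that by simp
  have cF1z: "continuous_on {- L..L} (\<lambda>t. F1 (z t))" and cF2z: "continuous_on {- L..L} (\<lambda>t. F2 (z t))"
    using pos by (auto intro!: continuous_on_compose2[OF cF1 cz] continuous_on_compose2[OF cF2 cz])
  have cW: "continuous_on {- L..L} W" and cW': "continuous_on {- L..L} W'"
    unfolding W_def W'_def by (intro continuous_intros cF1z cF2z cz')+
  have czz: "continuous_on {- L..L} zz"
    unfolding zz_def R_def by (intro continuous_intros cW cz')

  \<comment> \<open>The boundary condition gives zeros of \<open>z'\<close> only at the endpoints.
    Non-monotonicity makes \<open>z'\<close> strictly negative and strictly positive at interior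
    points, and the intermediate value theorem applies between these, in whichever order they
    lie.\<close>
  have "\<exists>b\<in>?I. z' b = 0"
  proof -
    have "\<exists>t\<in>?I. z' t < 0"
    proof (rule ccontr)
      assume "\<not> ?thesis"
      then have "z x \<le> z y" if "x \<in> {- L..L}" "y \<in> {- L..L}" "x \<le> y" for x y
        using that by (intro DERIV_nonneg_imp_increasing_open[OF \<open>x \<le> y\<close>])
          (auto intro!: exI[of _ "z' _"] zI continuous_on_subset[OF cz] simp: not_less)
      then show False using nonmono(1) by (auto simp: mono_on_def)
    qed
    then obtain x1 where x1: "x1 \<in> ?I" "z' x1 < 0" by blast
    have "\<exists>t\<in>?I. z' t > 0"
    proof (rule ccontr)
      assume *: "\<not> ?thesis"
      have "- z x \<le> - z y" if "x \<in> {- L..L}" "y \<in> {- L..L}" "x \<le> y" for x y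
        using that *
        by (intro DERIV_nonneg_imp_increasing_open[OF \<open>x \<le> y\<close>])
          (auto intro!: exI[of _ "- z' _"] DERIV_minus zI continuous_on_minus continuous_on_subset[OF cz]
            simp: not_less)
      then show False using nonmono(2) by (auto simp: monotone_on_def)
    qed
    then obtain x2 where x2: "x2 \<in> ?I" "z' x2 > 0" by blast
    have c: "continuous_on (closed_segment x1 x2) z'"
      by (rule continuous_on_subset[OF cz']) (use x1 x2 in \<open>auto simp: closed_segment_eq_real_ivl\<close>)
    have "0 \<in> closed_segment (z' x1) (z' x2)" using x1 x2 by (auto simp: closed_segment_eq_real_ivl)
    then obtain b where "b \<in> closed_segment x1 x2" "z' b = 0"
      using IVT'_closed_segment_real[OF _ c] by blast
    then show ?thesis using x1 x2 by (intro bexI[of _ b]) (auto simp: closed_segment_eq_real_ivl split: if_splits)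
  qed
  then obtain b where b: "b \<in> ?I" "z' b = 0" by blast
  \<comment> \<open>\<open>[a, q]\<close> is the largest subinterval that is symmetric about \<open>b\<close>; one of its ends is an end of
    the domain.\<close>
  define a q where "a = max (- L) (2 * b - L)" and "q = min L (2 * b + L)"
  have aq: "- L \<le> a" "a < b" "b < q" "q \<le> L" "a + q = 2 * b" "a = - L \<or> q = L"
    using b(1) by (auto simp: a_def q_def max_def min_def)

  have "\<exists>t0\<in>{- L..L}. \<forall>t\<in>{- L..L}. z t0 \<le> z t"
    using L by (intro continuous_attains_inf cz) auto
  then obtain lo where lo: "0 < lo" "\<And>t. t \<in> {- L..L} \<Longrightarrow> lo \<le> z t" using pos by blast
  have "\<exists>t0\<in>{- L..L}. \<forall>t\<in>{- L..L}. z t \<le> z t0"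
    using L by (intro continuous_attains_sup cz) auto
  then obtain hi where hi: "\<And>t. t \<in> {- L..L} \<Longrightarrow> z t \<le> hi" by blast
  have f: "((\<lambda>x. F1 x - \<sigma>) has_real_derivative F2 x) (at x)" if "x \<in> {lo..hi}" for x
    using DERIV_diff[OF F(2) DERIV_const, of x \<sigma>] that lo by simp
  have f': "continuous_on {lo..hi} F2" by (rule continuous_on_subset[OF cF2]) (use lo in auto)
  obtain R' where R': "\<And>v. (R has_real_derivative R' v) (at v)" "continuous_on UNIV R'"
  proof
    let ?s = "\<lambda>v. sqrt (1 + (\<epsilon> * v)\<^sup>2)"
    show "(R has_real_derivative 3 * ?s v * \<epsilon>\<^sup>2 * v) (at v)" for v
    proof -
      have s: "?s v > 0" using one_plus_square_pos[of "\<epsilon> * v"] by simp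
      have "(?s has_real_derivative (\<epsilon> * v) / ?s v * \<epsilon>) (at v)"
        by (rule DERIV_chain2[OF DERIV_sqrt_one_plus_square]) (auto intro!: derivative_eq_intros)
      from DERIV_power[OF this, of 3]
      have "(R has_real_derivative 3 * (\<epsilon> * v / ?s v * \<epsilon> * (?s v)\<^sup>2)) (at v)"
        unfolding R_def by simp
      moreover have "3 * (\<epsilon> * v / S * \<epsilon> * S\<^sup>2) = 3 * S * \<epsilon>\<^sup>2 * v" if "S > 0" for S
        using that by (simp add: power2_eq_square)
      ultimately show ?thesis using s by metis
    qed
    show "continuous_on UNIV (\<lambda>v. 3 * ?s v * \<epsilon>\<^sup>2 * v)" by (intro continuous_intros)
  qed
  note unique = autonomous_ode_unique[OF f f' R']

  \<comment> \<open>The reflected function solves the same equation because the equation is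
    autonomous and \<open>R\<close> is even. At \<open>b\<close> the values agree trivially, and the
    slopes agree because \<open>z' b = 0\<close>.\<close>
  have reflect: "z t = z (2 * b - t) \<and> z' t = - z' (2 * b - t)" if t: "t \<in> {a..q}" for t
  proof (rule unique[where a = a and b = q and t = t and ?t0.0 = b])
    have sub: "{a..q} \<subseteq> {- L..L}" using aq by auto
    have r: "2 * b - s \<in> {a..q}" if "s \<in> {a..q}" for s using that aq by auto
    have r': "2 * b - s \<in> {a<..<q}" if "s \<in> {a<..<q}" for s using that aq by auto
    have sI: "s \<in> ?I" if "s \<in> {a<..<q}" for s using that aq by auto
    show "continuous_on {a..q} z" "continuous_on {a..q} z'"
      using sub cz cz' by (auto intro: continuous_on_subset)
    show "z s \<in> {lo..hi}" if "s \<in> {a..q}" for s using lo(2)[of s] hi[of s] that sub by auto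
    show "z (2 * b - s) \<in> {lo..hi}" if "s \<in> {a..q}" for s
      using lo(2)[of "2 * b - s"] hi[of "2 * b - s"] r[OF that] sub by auto
    show "continuous_on {a..q} (\<lambda>s. z (2 * b - s))" "continuous_on {a..q} (\<lambda>s. - z' (2 * b - s))"
      using aq by (auto intro!: continuous_intros continuous_on_compose2[OF cz] continuous_on_compose2[OF cz'])
    fix s assume s: "s \<in> {a<..<q}"
    show "(z has_real_derivative z' s) (at s)" using zI sI s by blast
    show "(z' has_real_derivative (F1 (z s) - \<sigma>) * R (z' s)) (at s)"
      using z'I[OF sI[OF s]] by (simp add: zz_def W_def)
    have lin: "((\<lambda>s. 2 * b - s) has_real_derivative - 1) (at s)"
      by (auto intro!: derivative_eq_intros)
    show "((\<lambda>s. z (2 * b - s)) has_real_derivative - z' (2 * b - s)) (at s)"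
      using DERIV_chain2[OF zI[OF sI[OF r'[OF s]]] lin] by simp
    have "R (- v) = R v" for v by (simp add: R_def)
    then show "((\<lambda>s. - z' (2 * b - s)) has_real_derivative (F1 (z (2 * b - s)) - \<sigma>) * R (- z' (2 * b - s))) (at s)"
      using DERIV_minus[OF DERIV_chain2[OF z'I[OF sI[OF r'[OF s]]] lin]] by (simp add: zz_def W_def)
  qed (use aq b t in auto)
  have zq: "z q = z a" and z'aq: "z' a = 0" "z' q = 0"
  proof -
    have *: "z a = z q" "z' a = - z' q"
      using reflect[of a] aq unfolding aq(5)[symmetric] by auto
    then show "z q = z a" "z' a = 0" "z' q = 0" using aq(6) bc by auto
  qed

  define k where "k = W a"
  have Wq: "W q = k" using zq by (simp add: k_def W_def)
  \<comment> \<open>If \<open>k\<close> were 0, the constant \<open>z a\<close> would solve the same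
    equation with the same data at \<open>a\<close>, where \<open>z'\<close> vanishes; uniqueness on
    the whole domain would make \<open>z\<close> constant and thus monotone.\<close>
  have k: "k \<noteq> 0"
  proof
    assume "k = 0"
    then have k0: "F1 (z a) - \<sigma> = 0" by (simp add: k_def W_def)
    have za: "z a \<in> {lo..hi}" using lo hi aq by auto
    have "z t = z a \<and> z' t = 0" if t: "t \<in> {- L..L}" for t
      by (rule unique[where a = "- L" and b = L and t = t and ?t0.0 = a and y = "\<lambda>_. z a" and y' = "\<lambda>_. 0"])
        (use cz cz' lo hi za zI z'I k0 aq z'aq t in \<open>auto simp: zz_def W_def\<close>)
    then have "mono_on {- L..L} z" by (auto simp: mono_on_def)
    then show False using nonmono by simp
  qed

  let ?\<chi> = "\<lambda>f t. if t \<in> {a<..<q} then f t else (0::real)"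
  have sub: "{a..q} \<subseteq> {- L..L}" and subI: "{a<..<q} \<subseteq> ?I" using aq by auto
  \<comment> \<open>Used for the variation with u = z', and for primitives of cut-off integrands
    with u equal to \<open>z\<close>, W z' and W t.\<close>
  have clamp: "pw_deriv (- L) L (\<lambda>t. u (max a (min q t))) (?\<chi> v)"
    if "continuous_on {- L..L} u" "continuous_on {- L..L} v"
      "\<And>t. t \<in> ?I \<Longrightarrow> (u has_real_derivative v t) (at t)" for u v
  proof (rule pw_deriv_clamp)
    show "pw_deriv a q u v"
    proof (rule pw_derivI[of _ _ _ _ "{}"])
      show "bounded (v ` {a<..<q})"
        using that(2) sub by (intro bounded_continuous_image) (rule continuous_on_subset)
      show "continuous_on ({a<..<q} - {}) v"
        using that(2) by (rule continuous_on_subset) (use aq in auto)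
    qed (use that sub subI in \<open>auto intro: continuous_on_subset\<close>)
  qed (use aq in auto)

  \<comment> \<open>The first summand of \<open>\<phi>\<close> is \<open>z'\<close> cut off outside \<open>[a, q]\<close>, on which the second variation vanishes;
    its mixed term with \<open>t\<close> is \<open>k (q - a) \<noteq> 0\<close>.  The coefficient \<open>\<delta>\<close> makes the linear term negative
    and small enough to dominate the quadratic term \<open>\<delta>\<^sup>2 B0\<close>.\<close>
  define B0 where "B0 = (\<integral>t. Q2 (\<epsilon> * z' t) + F2 (z t) * t\<^sup>2 \<partial>?M)"
  define \<eta> where "\<eta> = (q - a) / (\<bar>B0\<bar> + 1)"
  define \<delta> where "\<delta> = - k * \<eta>"
  define \<phi> where "\<phi> = (\<lambda>t. z' (max a (min q t)) + \<delta> * t)"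
  define h where "h = (\<lambda>t. ?\<chi> zz t + \<delta>)"
  have pwt: "pw_deriv (- L) L (\<lambda>t. t) (\<lambda>_. 1)"
    by (rule pw_deriv_C1) (auto intro!: derivative_eq_intros)
  have pw\<phi>: "pw_deriv (- L) L \<phi> h"
    using pw_deriv_add[OF clamp[OF cz' czz z'I] pw_deriv_cmult[OF pwt, of \<delta>]] by (simp add: \<phi>_def h_def)
  \<comment> \<open>Clamping and cutting off agree here, since \<open>z'\<close> vanishes at both
    \<open>a\<close> and \<open>q\<close>.\<close>
  have \<phi>: "\<phi> t = ?\<chi> z' t + \<delta> * t" for t
    using z'aq aq by (auto simp: \<phi>_def max_def min_def)

  have mean: "(\<integral>t. \<phi> t \<partial>?M) = 0"
  proof -
    have pwt2: "pw_deriv (- L) L (\<lambda>t. t\<^sup>2 / 2) (\<lambda>t. t)"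
      by (rule pw_deriv_C1) (auto intro!: derivative_eq_intros)
    \<comment> \<open>The primitive of \<phi> has equal values at both ends of the domain: the
      clamped part gives \<open>z a\<close> and \<open>z q\<close>, and t^2 is even.\<close>
    have "pw_deriv (- L) L (\<lambda>t. z (max a (min q t)) + \<delta> * (t\<^sup>2 / 2)) \<phi>"
      unfolding \<phi>[abs_def] by (intro pw_deriv_add clamp cz cz' zI pw_deriv_cmult pwt2)
    from pw_deriv_integral(2)[OF L(2) this] show ?thesis
      using aq zq by (simp add: max_def min_def)
  qed

  \<comment> \<open>The flux. The equation in divergence form says that its derivative is
    \<open>W\<close>.\<close>
  define P where "P = (\<lambda>t. Q1 (\<epsilon> * z' t) / \<epsilon>)"
  have pwP: "pw_deriv (- L) L P W"
  proof (rule pw_derivI[of _ _ _ _ "{}"])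
    have "continuous_on UNIV Q1"
      using DERIV_isCont[OF DERIV_Q1] by (intro continuous_at_imp_continuous_on) auto
    then have "continuous_on {- L..L} (\<lambda>t. Q1 (\<epsilon> * z' t))"
      by (rule continuous_on_compose2) (auto intro!: continuous_intros cz')
    then show "continuous_on {- L..L} P" unfolding P_def using \<epsilon> by (intro continuous_intros) auto
    show "(P has_real_derivative W t) (at t)" if "t \<in> ?I - {}" for t
    proof -
      have "(P has_real_derivative Q2 (\<epsilon> * z' t) * (\<epsilon> * zz t) / \<epsilon>) (at t)"
        unfolding P_def
        by (intro DERIV_cdivide DERIV_chain2[OF DERIV_Q1] DERIV_cmult z'I) (use that in simp)
      then show ?thesis using \<epsilon> Qzz[of t] by simp
    qed
    show "bounded (W ` ?I)" by (rule bounded_continuous_image[OF cW])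
    show "continuous_on (?I - {}) W" by (rule continuous_on_subset[OF cW]) auto
  qed simp
  have i\<phi>: "integrable ?M \<phi>"
    using pw\<phi> by (auto simp: pw_deriv_def
        intro!: integrable_bounded_image continuous_on_Icc_measurable bounded_continuous_image)
  \<comment> \<open>\<sigma> acts as the Lagrange multiplier of the mass constraint: the term
    \<sigma> \<phi> integrates to zero, so \<open>W\<close> may be exchanged for
    \<open>F1 (z t)\<close>.\<close>
  have E1: "P t * h t + W t * \<phi> t + \<sigma> * \<phi> t = Q1 (\<epsilon> * z' t) / \<epsilon> * h t + F1 (z t) * \<phi> t" for t
    by (simp add: P_def W_def algebra_simps)
  \<comment> \<open>The integrand is the derivative of P \<phi>. Its end values vanish because
    \<open>P\<close> is zero where \<open>z'\<close> is, whatever the values of \<phi>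
    there.\<close>
  have P\<phi>: "integrable ?M (\<lambda>t. P t * h t + W t * \<phi> t)" "(\<integral>t. P t * h t + W t * \<phi> t \<partial>?M) = 0"
    using pw_deriv_integral[OF L(2) pw_deriv_mult[OF pwP pw\<phi>]] bc by (auto simp: P_def Q1_def)
  have first: "integrable ?M (\<lambda>t. Q1 (\<epsilon> * z' t) / \<epsilon> * h t + F1 (z t) * \<phi> t)"
    "(\<integral>t. Q1 (\<epsilon> * z' t) / \<epsilon> * h t + F1 (z t) * \<phi> t \<partial>?M) = 0"
    using P\<phi> i\<phi> mean unfolding E1[symmetric] by simp_all

  have second: "(\<integral>t. Q2 (\<epsilon> * z' t) * (h t)\<^sup>2 + F2 (z t) * (\<phi> t)\<^sup>2 \<partial>?M) < 0"
  proof -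
    \<comment> \<open>Replacing Q2 (\<epsilon> z') zz by \<open>W\<close> and F2 (z) z' by
      \<open>W'\<close> exhibits the first two groups as the derivatives of W z' and W t on (a,q);
      only the part quadratic in \<delta> is left as an integral.\<close>
    have "Q2 (\<epsilon> * z' t) * (h t)\<^sup>2 + F2 (z t) * (\<phi> t)\<^sup>2 =
        ?\<chi> (\<lambda>t. W t * zz t + W' t * z' t) t + (2 * \<delta>) * ?\<chi> (\<lambda>t. W t * 1 + W' t * t) t
        + \<delta>\<^sup>2 * (Q2 (\<epsilon> * z' t) + F2 (z t) * t\<^sup>2)" for t
      unfolding \<phi> h_def W'_def Qzz[symmetric]
      by (simp add: algebra_simps power2_eq_square)
    moreover have D1: "pw_deriv (- L) L (\<lambda>t. (\<lambda>t. W t * z' t) (max a (min q t))) (?\<chi> (\<lambda>t. W t * zz t + W' t * z' t))"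
      by (rule clamp) (auto intro!: continuous_intros cW cW' cz' czz DERIV_mult' W z'I)
    moreover have D2: "pw_deriv (- L) L (\<lambda>t. (\<lambda>t. W t * t) (max a (min q t))) (?\<chi> (\<lambda>t. W t * 1 + W' t * t))"
      by (rule clamp) (auto intro!: continuous_intros cW cW' DERIV_mult'[OF W DERIV_ident, simplified])
    moreover have "integrable ?M (\<lambda>t. Q2 (\<epsilon> * z' t) + F2 (z t) * t\<^sup>2)"
    proof -
      have "continuous_on UNIV Q2"
        using DERIV_isCont[OF DERIV_Q2] by (intro continuous_at_imp_continuous_on) auto
      then have "continuous_on {- L..L} (\<lambda>t. Q2 (\<epsilon> * z' t))"
        by (rule continuous_on_compose2) (auto intro!: continuous_intros cz')
      then have "continuous_on {- L..L} (\<lambda>t. Q2 (\<epsilon> * z' t) + F2 (z t) * t\<^sup>2)"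
        by (intro continuous_intros cF2z)
      then show ?thesis
        by (intro integrable_bounded_image continuous_on_Icc_measurable bounded_continuous_image)
    qed
    ultimately have "(\<integral>t. Q2 (\<epsilon> * z' t) * (h t)\<^sup>2 + F2 (z t) * (\<phi> t)\<^sup>2 \<partial>?M) =
        (\<integral>t. ?\<chi> (\<lambda>t. W t * zz t + W' t * z' t) t \<partial>?M) + 2 * \<delta> * (\<integral>t. ?\<chi> (\<lambda>t. W t * 1 + W' t * t) t \<partial>?M)
        + \<delta>\<^sup>2 * B0"
      using pw_deriv_integral(1)[OF L(2) D1] pw_deriv_integral(1)[OF L(2) D2] unfolding B0_def by simp
    \<comment> \<open>W z' vanishes at both ends of [a,q], and \<open>W\<close> has the same value
      \<open>k\<close> at both, so W t contributes k q - k a.\<close>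
    also have "\<dots> = 2 * \<delta> * (k * q - k * a) + \<delta>\<^sup>2 * B0"
      using pw_deriv_integral(2)[OF L(2) D1] pw_deriv_integral(2)[OF L(2) D2] aq z'aq Wq
      by (simp add: max_def min_def k_def)
    also have "\<dots> = \<eta> * k\<^sup>2 * (\<eta> * B0 - 2 * (q - a))"
      by (simp add: \<delta>_def algebra_simps power2_eq_square)
    also have "\<dots> < 0"
    proof -
      have \<eta>: "0 < \<eta>" using aq by (auto simp: \<eta>_def intro!: divide_pos_pos)
      \<comment> \<open>By the choice of \<eta>, the quadratic term can cancel at most half of the
        gain 2 (q - a); the added 1 keeps the denominator positive even if \<open>B0\<close> is
        0.\<close>
      have "\<eta> * B0 \<le> \<eta> * (\<bar>B0\<bar> + 1)" using \<eta> by (intro mult_left_mono) auto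
      also have "\<dots> = q - a" by (simp add: \<eta>_def)
      finally have "\<eta> * B0 - 2 * (q - a) < 0" using aq by simp
      then show ?thesis using \<eta> k by (intro mult_pos_neg) auto
    qed
    finally show ?thesis .
  qed
  show ?thesis
    by (rule not_local_minimizer_of_second_variation[where g = z' and \<phi> = \<phi> and h = h
        and ?F1.0 = F1 and ?F2.0 = F2 and ?F3.0 = F3])
      (use \<epsilon> pwz pos pw\<phi> F mean first second in \<open>auto simp: L_def\<close>)
qed

theorem proposition6:
  fixes F :: "real \<Rightarrow> real" and \<alpha> \<beta> \<epsilon> r \<sigma> :: real
    and F'0 F'inf :: ereal and z :: "real \<Rightarrow> real"
  assumes "0 < \<alpha>" and "\<alpha> < \<beta>"
    and "Ck_on 5 F {0<..}"
    and "\<forall>s\<in>{0<..<\<alpha>} \<union> {\<beta><..}. (deriv ^^ 2) F s > 0"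
    and "\<forall>s\<in>{\<alpha><..<\<beta>}. (deriv ^^ 2) F s < 0"
    and "((\<lambda>s. ereal (deriv F s)) \<longlongrightarrow> F'0) (at_right 0)"
    and "((\<lambda>s. ereal (deriv F s)) \<longlongrightarrow> F'inf) at_top"
    and "F'0 < ereal (deriv F \<beta>)"
    and "F'inf > ereal (deriv F \<alpha>)"
    and "\<epsilon> > 0" and "r > 0"
    and "neumann_solution F \<epsilon> \<sigma> z"
    and "(\<integral>t. z t \<partial>lebesgue_on {- inverse \<epsilon><..<inverse \<epsilon>}) = 2 * r * inverse \<epsilon>"
    and "\<not> (mono_on {- inverse \<epsilon>..inverse \<epsilon>} z \<or> antimono_on {- inverse \<epsilon>..inverse \<epsilon>} z)"
  shows "\<not> local_minimizer F \<epsilon> r z"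
proof -
  have D: "((deriv ^^ j) F has_real_derivative (deriv ^^ Suc j) F x) (at x)" if "j < 5" "x > 0" for j x
  proof -
    have "(deriv ^^ j) F differentiable_on {0<..}" using assms(3) that(1) by (auto simp: Ck_on_def)
    then have "(deriv ^^ j) F differentiable (at x)"
      using that(2) by (simp add: differentiable_on_eq_differentiable_at)
    then have "((deriv ^^ j) F has_real_derivative deriv ((deriv ^^ j) F) x) (at x)"
      by (simp add: DERIV_deriv_iff_real_differentiable)
    then show ?thesis by simp
  qed
  have c3: "continuous_on {0<..} ((deriv ^^ 3) F)"
    using D[of 3] by (intro continuous_at_imp_continuous_on ballI DERIV_isCont) auto
  obtain z' z'' where sol: "\<forall>t\<in>{- inverse \<epsilon>..inverse \<epsilon>}.
        (z has_real_derivative z' t) (at t within {- inverse \<epsilon>..inverse \<epsilon>})"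
      "continuous_on {- inverse \<epsilon>..inverse \<epsilon>} z'"
      "\<forall>t\<in>{- inverse \<epsilon><..<inverse \<epsilon>}. (z' has_real_derivative z'' t) (at t) \<and>
        (deriv ^^ 2) Q (\<epsilon> * z' t) * z'' t = deriv F (z t) - \<sigma>"
      "z' (- inverse \<epsilon>) = 0" "z' (inverse \<epsilon>) = 0"
    using assms(12) unfolding neumann_solution_def by blast
  have pos: "\<forall>t\<in>{- inverse \<epsilon>..inverse \<epsilon>}. z t > 0"
    using assms(12) unfolding neumann_solution_def by blast
  show ?thesis
  proof (rule ode_nonmonotone_not_local_minimizer[where ?F1.0 = "deriv F" and ?F2.0 = "(deriv ^^ 2) F"
        and ?F3.0 = "(deriv ^^ 3) F" and z' = z' and z'' = z'' and \<sigma> = \<sigma>])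
    show "(F has_real_derivative deriv F x) (at x)" if "x > 0" for x using D[of 0] that by simp
    show "(deriv F has_real_derivative (deriv ^^ 2) F x) (at x)" if "x > 0" for x
      using D[of 1] that by (simp add: numeral_2_eq_2)
    show "((deriv ^^ 2) F has_real_derivative (deriv ^^ 3) F x) (at x)" if "x > 0" for x
      using D[of 2] that by (simp add: numeral_3_eq_3 numeral_2_eq_2)
    show "Q2 (\<epsilon> * z' t) * z'' t = deriv F (z t) - \<sigma>" if "t \<in> {- inverse \<epsilon><..<inverse \<epsilon>}" for t
      using sol(3) that by (simp add: deriv_deriv_Q)
  qed (use assms(10,14) pos sol c3 in auto)
qed

end
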